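(* Let $\nu>10$ and $r>\nu+\nu^{1/3}$ be real numbers, and let $J_\nu$ be the Bessel function of order $\nu$. (1) One has $$J_\nu(r)=\frac1{\sqrt{2\pi}}\frac{e^{i\theta(r)}+e^{-i\theta(r)}}{(r^2-\nu^2)^{1/4}}+h(\nu,r),\qquad \theta(r)=(r^2-\nu^2)^{1/2}-\nu\arccos\frac{\nu}{r}-\frac{\pi}{4},$$ where $$|h(\nu,r)|\lesssim\left(\frac{\nu^2}{(r^2-\nu^2)^{7/4}}+\frac1r\right)1_{[\nu+\nu^{1/3},2\nu]}(r)+r^{-1}1_{[2\nu,\infty)}(r).$$ (2) Let $x_0=\arccos\frac{\nu}{r}$. For every $K\in\mathbb{N}$ one has $$h(\nu,r)=(2\pi)^{-1/2}e^{i\theta(r)}x_0\sum_{k=1}^K\frac{(rx_0^3)^{-k-1/2}a_k(x_0)}{k!}+(2\pi)^{-1/2}e^{-i\theta(r)}x_0\sum_{k=1}^K\frac{(rx_0^3)^{-k-1/2}\tilde a_k(x_0)}{k!}+\tilde h(\nu,r)$$ with functions $a_k,\tilde a_k$ satisfying $|\partial^l a_k|+|\partial^l\tilde a_k|\lesssim1$ for every $l\in\mathbb{N}$, and $$|\tilde h(\nu,r)|\lesssim\left(\frac{r^{\frac K2+\frac14}}{(r-\nu)^{\frac{3K}2+\frac74}}+\frac1r\right)1_{[\nu+\nu^{1/3},2\nu]}(r)+r^{-1}1_{[2\nu,\infty)}(r).$$ Moreover, if $\nu\in\mathbb{Z}$, one has the better estimate $$|\tilde h(\nu,r)|\lesssim\frac{r^{\frac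 K2+\frac14}}{(r-\nu)^{\frac{3K}2+\frac74}}1_{[\nu+\nu^{1/3},2\nu]}(r)+r^{-3/2}1_{[2\nu,\infty)}(r).$$
   Context: $J_\nu(r)=\frac{(r/2)^\nu}{\Gamma(\nu+1/2)\pi^{1/2}}\int_{-1}^1e^{irt}(1-t^2)^{\nu-1/2}\,dt$ for $\nu>-1/2$. $\mathbb{N}=\{0,1,2,\dots\}$; $1_E$ denotes the indicator function of the set $E$. The notation $A\lesssim B$ means $A\le CB$ with a constant $C$ independent of $\nu$ and $r$ (in part (2), $C$ may depend on $K$, and in the derivative bounds on $k$ and $l$). The $a_k,\tilde a_k$ are smooth complex-valued functions of the single variable $x_0\in(0,\pi/2)$. *)

theory Defs
  imports "HOL-Analysis.Analysis"
begin

text \<open>Poisson's integral representation, the definition of the Bessel function for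
  \<open>\<nu> > -1/2\<close> and \<open>r > 0\<close>. It is stated complex-valued, as the integrand is.\<close>
definition bessel_J :: "real \<Rightarrow> real \<Rightarrow> complex" where
  "bessel_J \<nu> r =
     of_real ((r / 2) powr \<nu> / (Gamma (\<nu> + 1/2) * pi powr (1/2))) *
     integral {-1..1} (\<lambda>t. exp (\<i> * of_real (r * t)) * of_real ((1 - t\<^sup>2) powr (\<nu> - 1/2)))"

definition bessel_theta :: "real \<Rightarrow> real \<Rightarrow> real" where
  "bessel_theta \<nu> r = (r\<^sup>2 - \<nu>\<^sup>2) powr (1/2) - \<nu> * arccos (\<nu> / r) - pi / 4"

definition bessel_angle :: "real \<Rightarrow> real \<Rightarrow> real" where
  "bessel_angle \<nu> r = arccos (\<nu> / r)"

definition bessel_main :: "real \<Rightarrow> real \<Rightarrow> complex" where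
  "bessel_main \<nu> r =
     of_real (1 / sqrt (2 * pi)) *
     (exp (\<i> * of_real (bessel_theta \<nu> r)) + exp (- \<i> * of_real (bessel_theta \<nu> r))) /
     of_real ((r\<^sup>2 - \<nu>\<^sup>2) powr (1/4))"

definition bessel_sum :: "(nat \<Rightarrow> real \<Rightarrow> complex) \<Rightarrow> nat \<Rightarrow> real \<Rightarrow> real \<Rightarrow> complex" where
  "bessel_sum a K \<nu> r =
     (let x\<^sub>0 = bessel_angle \<nu> r
      in of_real x\<^sub>0 * (\<Sum>k = 1..K. of_real ((r * x\<^sub>0 ^ 3) powr (- real k - 1/2)) * a k x\<^sub>0 / fact k))"

text \<open>Iterated derivative of a function of a real variable. It is only used at points of an
  open interval on which all the iterates are differentiable, so that the default value of
  \<^const>\<open>vector_derivative\<close> never matters.\<close>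
definition nth_derivative :: "nat \<Rightarrow> (real \<Rightarrow> complex) \<Rightarrow> real \<Rightarrow> complex" where
  "nth_derivative l f = ((\<lambda>g x. vector_derivative g (at x)) ^^ l) f"

definition smooth_on_open :: "real set \<Rightarrow> (real \<Rightarrow> complex) \<Rightarrow> bool" where
  "smooth_on_open S f \<longleftrightarrow> open S \<and> (\<forall>l. \<forall>x\<in>S. nth_derivative l f differentiable (at x))"

end

theory Submission
  imports Defs "HOL-Complex_Analysis.Complex_Analysis" "HOL-Real_Asymp.Real_Asymp"
begin

text \<open>
  All bounds follow from the Debye expansion of \<open>J\<^sub>\<nu>\<close>, with an error that is uniform in
  \<open>r > \<nu> + \<nu>\<^bsup>1/3\<^esup>\<close>.

  In the variable \<open>p = \<nu> / \<surd>(r\<^sup>2 - \<nu>\<^sup>2) = cot x\<^sub>0\<close> (so \<open>p \<rightarrow> 0\<close> as \<open>r \<rightarrow> \<infinity>\<close>) the function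
  \<open>W = (r\<^sup>2 - \<nu>\<^sup>2)\<^bsup>1/4\<^esup> J\<^sub>\<nu>\<close> satisfies a first order system with rational coefficients,
  \<open>W' = - \<kappa> V\<close>, \<open>V' = (\<kappa> + (1 + 5p\<^sup>2) / 4\<nu>) W\<close> with \<open>\<kappa> = \<nu> / (p\<^sup>2 (1 + p\<^sup>2))\<close>. The WKB ansatz
  \<open>e\<^bsup>i\<theta>\<^esup> \<Sum> \<nu>\<^bsup>-k\<^esup> Z\<^sub>k(p)\<close> leads to the polynomials \<open>Z\<^sub>k\<close> of Debye, and truncating after \<open>k = K\<close>
  leaves the residual \<open>2i \<nu>\<^bsup>-K-1\<^esup> Z\<^sub>K\<^sub>+\<^sub>1'(p)\<close>. As the term \<open>\<kappa>\<close> drops out of the derivative of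
  the energy \<open>|D|\<^sup>2 + |F|\<^sup>2\<close> of the errors \<open>D\<close>, \<open>F\<close> in \<open>W\<close>, \<open>V\<close>, a Gronwall argument started at \<open>p = 0\<close> bounds these
  errors by \<open>\<nu>\<^bsup>-K-1\<^esup> (p + p\<^bsup>3K+3\<^esup>)\<close> as long as \<open>p\<^sup>3 \<le> \<nu>\<close>.

  To start the argument one only needs the asymptotics of \<open>J\<^sub>\<nu>\<close> as \<open>r \<rightarrow> \<infinity>\<close> for fixed \<open>\<nu>\<close>. It is
  obtained by moving the Poisson integral to vertical segments at \<open>\<plusminus>1\<close>, up to an
  exponentially small term.
\<close>

section \<open>The Debye polynomials\<close>

text \<open>The primitive without constant term. This choice of integration constant makes every
  \<open>debye k\<close> with k > 0 vanish at p = 0, so that all truncations of the WKB series have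
  the same limit there.\<close>

definition antideriv :: "complex poly \<Rightarrow> complex poly" where
  "antideriv A = (\<Sum>i\<le>degree A. monom (coeff A i / of_nat (Suc i)) (Suc i))"

lemma pderiv_sum: "pderiv (sum f S) = (\<Sum>i\<in>S. pderiv (f i))"
  for f :: "'b \<Rightarrow> 'a :: {comm_semiring_1, semiring_no_zero_divisors} poly"
  by (induction S rule: infinite_finite_induct) (simp_all add: pderiv_add)

lemma pderiv_antideriv: "pderiv (antideriv A) = A"
proof -
  have "pderiv (antideriv A) = (\<Sum>i\<le>degree A. pderiv (monom (coeff A i / of_nat (Suc i)) (Suc i)))"
    unfolding antideriv_def using pderiv_sum by simp
  also have "\<dots> = (\<Sum>i\<le>degree A. monom (coeff A i) i)"
    by (intro sum.cong) (auto simp: pderiv_monom simp del: of_nat_Suc)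
  finally show ?thesis by (simp add: poly_as_sum_of_monoms)
qed

lemma coeff_antideriv_0: "coeff (antideriv A) 0 = 0"
  by (simp add: antideriv_def coeff_sum)

lemma coeff_antideriv_Suc: "coeff (antideriv A) (Suc i) = coeff A i / of_nat (Suc i)"
proof -
  have "coeff A i = of_nat (Suc i) * coeff (antideriv A) (Suc i)"
    using coeff_pderiv[of "antideriv A" i] by (simp add: pderiv_antideriv)
  then show ?thesis by (simp add: field_simps del: of_nat_Suc)
qed

text \<open>In terms of the classical Debye polynomials U_k, \<open>debye k\<close> at p is U_k(-i
  p). The list [:0, 0, 1, 0, 1:] is p^2 (1 + p^2) = \<nu> / \<kappa>, and [:1/4, 0, 5/4:] is \<nu>
  times the coefficient that accompanies \<kappa> in the system for W and V.\<close>

primrec debye :: "nat \<Rightarrow> complex poly" where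
  "debye 0 = 1"
| "debye (Suc k) = smult (1 / (2 * \<i>))
     ([:0, 0, 1, 0, 1:] * pderiv (debye k) + antideriv ([:1/4, 0, 5/4:] * debye k))"

declare debye.simps(2) [simp del]

text \<open>The transport equation between consecutive orders in 1/\<nu>; in this differentiated
  form the terms of the truncated series cancel in pairs.\<close>

lemma pderiv_debye_Suc:
  "smult (2 * \<i>) (pderiv (debye (Suc k))) =
     pderiv ([:0, 0, 1, 0, 1:] * pderiv (debye k)) + [:1/4, 0, 5/4:] * debye k"
  unfolding debye.simps pderiv_smult pderiv_add pderiv_antideriv by simp

text \<open>A recursion step raises exponents by 1 or 3: p^2 d/dp and the primitive of 1/4 by 1, p^4
  d/dp and the primitive of 5 p^2 / 4 by 3. The upper limit governs the growth of the error; the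
  limits 3k and k make the amplitudes regular at x_0 = 0 and x_0 = pi/2, respectively.\<close>

lemma coeff_debye_eq_0:
  assumes "j < k \<or> 3 * k < j"
  shows "coeff (debye k) j = 0"
  using assms
proof (induction k arbitrary: j)
  case 0
  then show ?case by simp
next
  case (Suc k)
  have A: "[:0, 0, 1, 0, 1:] * pderiv (debye k)
           = monom 1 2 * pderiv (debye k) + monom 1 4 * pderiv (debye k)"
    by (simp add: monom_altdef algebra_simps numeral_eq_Suc)
  have B: "[:1/4, 0, 5/4:] * debye k = smult (1/4) (debye k) + monom (5/4) 2 * debye k"
    by (simp add: monom_altdef algebra_simps numeral_eq_Suc)
  have 1: "coeff (monom 1 2 * pderiv (debye k)) j = 0"
    using Suc.prems by (auto simp: coeff_monom_mult coeff_pderiv intro!: Suc.IH)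
  have 2: "coeff (monom 1 4 * pderiv (debye k)) j = 0"
    using Suc.prems by (auto simp: coeff_monom_mult coeff_pderiv intro!: Suc.IH)
  have 3: "coeff (antideriv ([:1/4, 0, 5/4:] * debye k)) j = 0"
  proof (cases j)
    case 0
    then show ?thesis by (simp add: coeff_antideriv_0)
  next
    case (Suc i)
    have "coeff (debye k) i = 0"
      using Suc.prems Suc by (intro Suc.IH) auto
    moreover have "coeff (monom (5/4) 2 * debye k) i = 0"
      using Suc.prems Suc by (auto simp: coeff_monom_mult intro!: Suc.IH)
    ultimately show ?thesis
      unfolding Suc coeff_antideriv_Suc B by simp
  qed
  show ?case
    unfolding debye.simps A coeff_smult coeff_add 1 2 3 by simp
qed

lemma poly_debye:
  "poly (debye k) x = (\<Sum>j=k..3*k. coeff (debye k) j * x ^ j)"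
proof -
  have "degree (debye k) \<le> 3 * k"
    by (intro degree_le) (auto intro: coeff_debye_eq_0)
  then have "poly (debye k) x = (\<Sum>j\<le>3*k. coeff (debye k) j * x ^ j)"
    unfolding poly_altdef by (intro sum.mono_neutral_left) (auto simp: coeff_eq_0)
  also have "\<dots> = (\<Sum>j=k..3*k. coeff (debye k) j * x ^ j)"
    by (intro sum.mono_neutral_right) (auto simp: coeff_debye_eq_0)
  finally show ?thesis .
qed

lemma poly_debye_0: "poly (debye k) 0 = (if k = 0 then 1 else 0)"
  unfolding poly_0_coeff_0 by (cases "k = 0") (auto intro: coeff_debye_eq_0)

section \<open>Energy estimate\<close>

text \<open>The weight \<open>exp (- b - m / M)\<close> makes \<open>|D|\<^sup>2 + |F|\<^sup>2 + M\<^sup>2\<close> decreasing; adding \<open>M\<^sup>2\<close> absorbs the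
  inhomogeneity \<open>G\<close> without differentiating a square root.\<close>
lemma energy_estimate:
  fixes D F G :: "real \<Rightarrow> complex" and \<kappa> b b' m m' :: "real \<Rightarrow> real"
  assumes P: "P > 0" and M: "M > 0" "m P \<le> M"
    and D: "\<And>x. 0 < x \<Longrightarrow> x \<le> P \<Longrightarrow>
      (D has_vector_derivative - of_real (\<kappa> x) * F x) (at x)"
    and F: "\<And>x. 0 < x \<Longrightarrow> x \<le> P \<Longrightarrow>
      (F has_vector_derivative of_real (\<kappa> x + b' x) * D x + G x) (at x)"
    and G: "\<And>x. 0 < x \<Longrightarrow> x \<le> P \<Longrightarrow> norm (G x) \<le> m' x"
    and b: "\<And>x. 0 < x \<Longrightarrow> x \<le> P \<Longrightarrow> (b has_real_derivative b' x) (at x)"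
    and m: "\<And>x. 0 < x \<Longrightarrow> x \<le> P \<Longrightarrow> (m has_real_derivative m' x) (at x)"
    and b'_nonneg: "\<And>x. 0 < x \<Longrightarrow> x \<le> P \<Longrightarrow> b' x \<ge> 0"
    and lims: "(D \<longlongrightarrow> 0) (at_right 0)" "(F \<longlongrightarrow> 0) (at_right 0)"
      "(b \<longlongrightarrow> 0) (at_right 0)" "(m \<longlongrightarrow> 0) (at_right 0)"
  shows "norm (D P) \<le> M * exp ((b P + 1) / 2)"
proof -
  define E where "E = (\<lambda>x. D x \<bullet> D x + F x \<bullet> F x)"
  define \<Phi> where "\<Phi> = (\<lambda>x. (E x + M\<^sup>2) * exp (- b x - m x / M))"
  define E' where "E' = (\<lambda>x. 2 * (F x \<bullet> (of_real (b' x) * D x + G x)))"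
  have inner_of_real: "x \<bullet> (of_real c * y) = c * (x \<bullet> y)" for x y :: complex and c :: real
    by (simp add: inner_complex_def algebra_simps)
  have E: "(E has_real_derivative E' x) (at x)" if "0 < x" "x \<le> P" for x
  proof -
    have "(E has_vector_derivative
        (D x \<bullet> (- of_real (\<kappa> x) * F x) + (- of_real (\<kappa> x) * F x) \<bullet> D x) +
        (F x \<bullet> (of_real (\<kappa> x + b' x) * D x + G x) + (of_real (\<kappa> x + b' x) * D x + G x) \<bullet> F x)) (at x)"
      unfolding E_def
      by (intro has_vector_derivative_add
          bounded_bilinear.has_vector_derivative[OF bounded_bilinear_inner] D F that)
    \<comment> \<open>The two contributions of \<open>\<kappa> x\<close> are opposite multiples of
      the inner product of D and F and cancel, however large \<kappa> becomes near 0.\<close>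
    moreover have "(D x \<bullet> (- of_real (\<kappa> x) * F x) + (- of_real (\<kappa> x) * F x) \<bullet> D x) +
        (F x \<bullet> (of_real (\<kappa> x + b' x) * D x + G x) + (of_real (\<kappa> x + b' x) * D x + G x) \<bullet> F x) = E' x"
      unfolding E'_def by (simp add: inner_complex_def algebra_simps)
    ultimately show ?thesis
      by (simp add: has_real_derivative_iff_has_vector_derivative)
  qed
  have E'_le: "E' x \<le> (b' x + m' x / M) * (E x + M\<^sup>2)" if "0 < x" "x \<le> P" for x
  proof -
    have 1: "2 * (F x \<bullet> D x) \<le> E x"
      using inner_ge_zero[of "F x - D x"] unfolding E_def
      by (simp add: inner_diff_left inner_diff_right inner_commute)
    have 2: "2 * (F x \<bullet> G x) \<le> m' x / M * (E x + M\<^sup>2)"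
    proof -
      have "F x \<bullet> G x \<le> norm (F x) * norm (G x)" by (rule norm_cauchy_schwarz)
      also have "\<dots> \<le> norm (F x) * m' x"
        using G[OF that] by (intro mult_left_mono) auto
      finally have "2 * (F x \<bullet> G x) \<le> m' x * (2 * norm (F x))" by (simp add: mult.commute)
      also have "2 * norm (F x) \<le> (E x + M\<^sup>2) / M"
      proof -
        have "0 \<le> (norm (F x) - M)\<^sup>2" by simp
        then have "2 * norm (F x) * M \<le> norm (F x) ^ 2 + M\<^sup>2"
          by (simp add: power2_eq_square algebra_simps)
        also have "\<dots> \<le> E x + M\<^sup>2"
          unfolding E_def by (simp add: power2_norm_eq_inner)
        finally show ?thesis using M by (simp add: field_simps)
      qed
      then have "m' x * (2 * norm (F x)) \<le> m' x * ((E x + M\<^sup>2) / M)"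
        using G[OF that] by (intro mult_left_mono) (auto intro: order_trans[OF norm_ge_zero])
      finally show ?thesis by simp
    qed
    have "E' x = b' x * (2 * (F x \<bullet> D x)) + 2 * (F x \<bullet> G x)"
      unfolding E'_def by (simp add: inner_add_right inner_of_real distrib_left)
    also have "b' x * (2 * (F x \<bullet> D x)) \<le> b' x * (E x + M\<^sup>2)"
      using 1 b'_nonneg[OF that] by (intro mult_left_mono) (auto intro: order_trans)
    finally show ?thesis using 2 by (simp add: algebra_simps)
  qed
  have \<Phi>: "\<exists>y. (\<Phi> has_real_derivative y) (at x) \<and> y \<le> 0" if "0 < x" "x \<le> P" for x
  proof (intro exI conjI)
    show "(\<Phi> has_real_derivative
        (E' x - (b' x + m' x / M) * (E x + M\<^sup>2)) * exp (- b x - m x / M)) (at x)"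
      unfolding \<Phi>_def using M
      by (auto intro!: derivative_eq_intros E[OF that] b[OF that] m[OF that] simp: field_simps)
    show "(E' x - (b' x + m' x / M) * (E x + M\<^sup>2)) * exp (- b x - m x / M) \<le> 0"
      using E'_le[OF that] by (intro mult_nonpos_nonneg) auto
  qed
  have \<Phi>_mono: "\<Phi> P \<le> \<Phi> x" if "0 < x" "x \<le> P" for x
    by (rule DERIV_nonpos_imp_nonincreasing[OF that(2)]) (use \<Phi> that in auto)
  \<comment> \<open>Only the added square of M survives at 0. Limits replace initial values because
    \<kappa> is singular at 0 in the application.\<close>
  have "(\<Phi> \<longlongrightarrow> (0 \<bullet> 0 + 0 \<bullet> 0 + M\<^sup>2) * exp (- 0 - 0 / M)) (at_right 0)"
    unfolding \<Phi>_def E_def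
    using tendsto_inner[OF lims(1) lims(1)] tendsto_inner[OF lims(2) lims(2)] M
    by (intro tendsto_add tendsto_mult tendsto_exp tendsto_diff tendsto_minus
        tendsto_divide tendsto_const lims) auto
  then have lim: "(\<Phi> \<longlongrightarrow> M\<^sup>2) (at_right 0)" by simp
  have "\<Phi> P \<le> M\<^sup>2"
  proof (rule tendsto_lowerbound[OF lim])
    show "\<forall>\<^sub>F x in at_right 0. \<Phi> P \<le> \<Phi> x"
      using eventually_at_right_real[OF P] by eventually_elim (auto intro: \<Phi>_mono)
  qed simp
  then have "E P + M\<^sup>2 \<le> M\<^sup>2 * exp (b P + m P / M)"
    unfolding \<Phi>_def by (simp add: exp_minus exp_diff exp_add field_simps)
  \<comment> \<open>\<open>m P \<le> M\<close> turns the weight of the inhomogeneity into the single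
    factor e.\<close>
  also have "\<dots> \<le> M\<^sup>2 * exp (b P + 1)"
    using M by (intro mult_left_mono) auto
  finally have "E P \<le> M\<^sup>2 * exp (b P + 1)"
    by (smt (verit) zero_le_power2)
  then have "norm (D P) ^ 2 \<le> M\<^sup>2 * exp (b P + 1)"
    unfolding E_def power2_norm_eq_inner
    using inner_ge_zero[of "F P"] by linarith
  also have "\<dots> = (M * exp ((b P + 1) / 2))\<^sup>2"
    by (simp add: power_mult_distrib flip: exp_double)
  finally show ?thesis
    using M by (intro power2_le_imp_le[of "norm (D P)"]) auto
qed

section \<open>Recurrences for the Poisson integral\<close>

text \<open>The order is shifted: \<open>s = \<nu> - 1/2\<close>.\<close>
definition poisson_int :: "real \<Rightarrow> real \<Rightarrow> complex" where
  "poisson_int s r = integral {-1..1} (\<lambda>t. exp (\<i> * of_real (r * t)) * of_real ((1 - t\<^sup>2) powr s))"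

lemma bessel_J_poisson_int:
  "bessel_J \<nu> r = of_real ((r / 2) powr \<nu> / (Gamma (\<nu> + 1/2) * sqrt pi)) * poisson_int (\<nu> - 1/2) r"
  by (simp add: bessel_J_def poisson_int_def powr_half_sqrt)

lemma continuous_on_one_minus_square_powr:
  assumes "s > 0"
  shows "continuous_on {-1..1} (\<lambda>t::real. (1 - t\<^sup>2) powr s)"
proof (rule continuous_on_powr')
  show "\<forall>x\<in>{-1..1::real}. 0 \<le> 1 - x\<^sup>2 \<and> (1 - x\<^sup>2 = 0 \<longrightarrow> 0 < s)"
    using assms by (auto simp: abs_square_le_1 abs_le_iff)
qed (intro continuous_intros)+

lemma has_vector_derivative_fourier_integral:
  fixes w :: "real \<Rightarrow> complex"
  assumes w: "continuous_on {a..b} w"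
  shows "((\<lambda>r. integral {a..b} (\<lambda>t. exp (\<i> * of_real (r * t)) * w t)) has_vector_derivative
    integral {a..b} (\<lambda>t. exp (\<i> * of_real (r * t)) * (\<i> * of_real t * w t))) (at r)"
proof -
  have "((\<lambda>r. integral (cbox a b) (\<lambda>t. exp (\<i> * of_real (r * t)) * w t)) has_vector_derivative
    integral (cbox a b) (\<lambda>t. exp (\<i> * of_real (r * t)) * (\<i> * of_real t * w t))) (at r within UNIV)"
  proof (rule leibniz_rule_vector_derivative)
    fix x t :: real
    show "((\<lambda>x. exp (\<i> * of_real (x * t)) * w t) has_vector_derivative
        exp (\<i> * of_real (x * t)) * (\<i> * of_real t * w t)) (at x)"
      by (auto intro!: derivative_eq_intros has_vector_derivative_real_field)
  next
    fix x :: real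
    show "(\<lambda>t. exp (\<i> * of_real (x * t)) * w t) integrable_on cbox a b"
      using w by (intro integrable_continuous continuous_intros) auto
  next
    have "continuous_on (UNIV \<times> {a..b}) (\<lambda>p. w (snd p))"
      using w by (rule continuous_on_compose2) (auto intro: continuous_intros)
    then show "continuous_on (UNIV \<times> cbox a b)
       (\<lambda>(x, t). exp (\<i> * of_real (x * t)) * (\<i> * of_real t * w t))"
      unfolding split_beta by (intro continuous_intros) auto
  qed auto
  then show ?thesis by simp
qed

text \<open>With e = e^{irt} and w_s = (1 - t^2)^s, the first identity integrates the derivative of
  e w_{s+1}, the second that of t e w_{s+1}; the boundary terms vanish. \<open>T s\<close> carries
  an extra factor t, so that i \<open>T s\<close> is the r-derivative of the Poisson
  integral.\<close>

lemma poisson_int_parts: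
  fixes s r :: real
  assumes s: "s > 0"
  defines "T \<equiv> \<lambda>s. integral {-1..1} (\<lambda>t. exp (\<i> * of_real (r * t)) * (of_real t * of_real ((1 - t\<^sup>2) powr s)))"
  shows "\<i> * of_real r * poisson_int (s + 1) r = of_real (2 * (s + 1)) * T s"
    and "\<i> * of_real r * T (s + 1) = of_real (2 * (s + 1)) * poisson_int s r
           - of_real (2 * s + 3) * poisson_int (s + 1) r"
proof -
  define e where "e = (\<lambda>t. exp (\<i> * of_real (r * t)))"
  define w where "w = (\<lambda>s t. complex_of_real ((1 - t\<^sup>2) powr s))"
  have w_cont: "continuous_on {-1..1} (w s)" if "s > 0" for s
    unfolding w_def by (intro continuous_intros continuous_on_one_minus_square_powr that)
  have e_cont: "continuous_on {-1..1} e"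
    unfolding e_def by (intro continuous_intros)
  have w': "(w (s + 1) has_vector_derivative - of_real (2 * (s + 1)) * (of_real t * w s t)) (at t)"
    if "-1 < t" "t < 1" for t
  proof -
    have "1 - t\<^sup>2 > 0" using that by (simp add: abs_square_less_1 abs_less_iff)
    then have "((\<lambda>t. (1 - t\<^sup>2) powr (s + 1)) has_real_derivative - 2 * (s + 1) * (t * (1 - t\<^sup>2) powr s)) (at t)"
      by (auto intro!: derivative_eq_intros simp: algebra_simps)
    then have "((\<lambda>t. complex_of_real ((1 - t\<^sup>2) powr (s + 1))) has_vector_derivative
        of_real (- 2 * (s + 1) * (t * (1 - t\<^sup>2) powr s))) (at t)"
      using has_real_derivative_iff_has_vector_derivative has_vector_derivative_of_real by blast
    then show ?thesis by (simp add: w_def algebra_simps)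
  qed
  have e': "(e has_vector_derivative \<i> * of_real r * e t) (at t)" for t
    unfolding e_def by (auto intro!: derivative_eq_intros has_vector_derivative_real_field)
  \<comment> \<open>The convention \<open>0 powr s = 0\<close> removes the boundary terms in both
    integrations by parts.\<close>
  have w_end: "w s 1 = 0" "w s (-1) = 0" for s by (simp_all add: w_def)
  have I: "(\<lambda>t. e t * w s t) integrable_on {-1..1}" "(\<lambda>t. e t * (of_real t * w s t)) integrable_on {-1..1}"
    if "s > 0" for s
    by (intro integrable_continuous_interval continuous_intros e_cont w_cont that)+
  have P: "((\<lambda>t. e t * w s t) has_integral poisson_int s r) {-1..1}" if "s > 0" for s
    using I(1)[OF that] unfolding e_def w_def poisson_int_def by (rule integrable_integral)
  have T: "((\<lambda>t. e t * (of_real t * w s t)) has_integral T s) {-1..1}" if "s > 0" for s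
    using I(2)[OF that] unfolding e_def w_def T_def by (rule integrable_integral)
  define k where "k = complex_of_real (2 * (s + 1))"
  have ew': "((\<lambda>t. e t * w (s + 1) t) has_vector_derivative
      \<i> * of_real r * (e t * w (s + 1) t) - k * (e t * (of_real t * w s t))) (at t)"
    if "-1 < t" "t < 1" for t
    using has_vector_derivative_mult[OF e' w'[OF that]] by (simp add: k_def algebra_simps)
  have tew': "((\<lambda>t. of_real t * (e t * w (s + 1) t)) has_vector_derivative
      \<i> * of_real r * (e t * (of_real t * w (s + 1) t)) + e t * w (s + 1) t
         - k * (e t * (of_real (t\<^sup>2) * w s t))) (at t)"
    if "-1 < t" "t < 1" for t
    using has_vector_derivative_mult[OF has_vector_derivative_of_real[OF DERIV_ident] ew'[OF that]]
    by (simp add: k_def algebra_simps power2_eq_square)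
  have "((\<lambda>t. \<i> * of_real r * (e t * w (s + 1) t) - k * (e t * (of_real t * w s t)))
      has_integral e 1 * w (s + 1) 1 - e (-1) * w (s + 1) (-1)) {-1..1}"
  \<comment> \<open>The derivative is available only inside the interval, where 1 - t^2 > 0;
    continuity covers the endpoints.\<close>
  proof (rule fundamental_theorem_of_calculus_interior)
    show "continuous_on {-1..1} (\<lambda>t. e t * w (s + 1) t)"
      using s by (intro continuous_intros e_cont w_cont) auto
  qed (auto intro: ew')
  moreover have "((\<lambda>t. \<i> * of_real r * (e t * w (s + 1) t) - k * (e t * (of_real t * w s t)))
      has_integral \<i> * of_real r * poisson_int (s + 1) r - k * T s) {-1..1}"
    using s by (intro has_integral_diff has_integral_mult_right P T) auto
  ultimately have *: "\<i> * of_real r * poisson_int (s + 1) r - k * T s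
      = e 1 * w (s + 1) 1 - e (-1) * w (s + 1) (-1)"
    by (rule has_integral_unique[rotated])
  show "\<i> * of_real r * poisson_int (s + 1) r = of_real (2 * (s + 1)) * T s"
    using * unfolding w_end k_def by simp
  \<comment> \<open>Writing t^2 = 1 - (1 - t^2) trades the factor t^2 for a higher power, which
    closes the system in the orders s and s + 1.\<close>
  have w_split: "of_real (t\<^sup>2) * w s t = w s t - w (s + 1) t" if "t \<in> {-1..1}" for t
  proof (cases "t\<^sup>2 = 1")
    case False
    moreover have "t\<^sup>2 \<le> 1" using that by (simp add: abs_square_le_1 abs_le_iff)
    ultimately have "t\<^sup>2 * (1 - t\<^sup>2) powr s = (1 - t\<^sup>2) powr s - (1 - t\<^sup>2) powr (s + 1)"
      by (simp add: powr_add algebra_simps)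
    then show ?thesis unfolding w_def by (simp only: flip: of_real_mult of_real_diff)
  qed (simp add: w_def)
  have "((\<lambda>t. \<i> * of_real r * (e t * (of_real t * w (s + 1) t)) + e t * w (s + 1) t
         - k * (e t * (of_real (t\<^sup>2) * w s t)))
      has_integral of_real 1 * (e 1 * w (s + 1) 1) - of_real (-1) * (e (-1) * w (s + 1) (-1))) {-1..1}"
  proof (rule fundamental_theorem_of_calculus_interior)
    show "continuous_on {-1..1} (\<lambda>t. of_real t * (e t * w (s + 1) t))"
      using s by (intro continuous_intros e_cont w_cont) auto
  qed (auto intro: tew' simp del: of_real_power)
  moreover have "((\<lambda>t. \<i> * of_real r * (e t * (of_real t * w (s + 1) t)) + e t * w (s + 1) t
         - k * (e t * w s t - e t * w (s + 1) t))
      has_integral \<i> * of_real r * T (s + 1) + poisson_int (s + 1) r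
        - k * (poisson_int s r - poisson_int (s + 1) r)) {-1..1}"
    using s by (intro has_integral_diff has_integral_add has_integral_mult_right P T) auto
  then have "((\<lambda>t. \<i> * of_real r * (e t * (of_real t * w (s + 1) t)) + e t * w (s + 1) t
         - k * (e t * (of_real (t\<^sup>2) * w s t)))
      has_integral \<i> * of_real r * T (s + 1) + poisson_int (s + 1) r
        - k * (poisson_int s r - poisson_int (s + 1) r)) {-1..1}"
    by (rule has_integral_eq[rotated]) (simp only: w_split right_diff_distrib)
  ultimately have *: "\<i> * of_real r * T (s + 1) + poisson_int (s + 1) r
        - k * (poisson_int s r - poisson_int (s + 1) r)
      = of_real 1 * (e 1 * w (s + 1) 1) - of_real (-1) * (e (-1) * w (s + 1) (-1))"
    by (rule has_integral_unique[rotated])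
  then show "\<i> * of_real r * T (s + 1) = of_real (2 * (s + 1)) * poisson_int s r
           - of_real (2 * s + 3) * poisson_int (s + 1) r"
    unfolding w_end k_def by (simp add: algebra_simps)
qed

text \<open>Differentiation under the integral gives i \<open>T s\<close>; the two integrations by
  parts then eliminate \<open>T s\<close> and \<open>T (s + 1)\<close>, which leaves a closed first
  order system for the orders s and s + 1.\<close>

lemma poisson_int_deriv:
  assumes s: "s > 0"
  shows "(poisson_int s has_vector_derivative - of_real (r / (2 * (s + 1))) * poisson_int (s + 1) r) (at r)"
    and "r \<noteq> 0 \<Longrightarrow> (poisson_int (s + 1) has_vector_derivative
      of_real (2 * (s + 1) / r) * poisson_int s r - of_real ((2 * s + 3) / r) * poisson_int (s + 1) r) (at r)"
proof -
  define T where "T = (\<lambda>s. integral {-1..1} (\<lambda>t. exp (\<i> * of_real (r * t)) * (of_real t * of_real ((1 - t\<^sup>2) powr s))))"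
  have der: "(poisson_int s has_vector_derivative \<i> * T s) (at r)" if "s > 0" for s
  proof -
    have "(poisson_int s has_vector_derivative
      integral {-1..1} (\<lambda>t. exp (\<i> * of_real (r * t)) * (\<i> * of_real t * of_real ((1 - t\<^sup>2) powr s)))) (at r)"
      unfolding poisson_int_def
      by (intro has_vector_derivative_fourier_integral continuous_intros
          continuous_on_one_minus_square_powr that)
    moreover have "integral {-1..1} (\<lambda>t. exp (\<i> * of_real (r * t)) * (\<i> * of_real t * of_real ((1 - t\<^sup>2) powr s)))
        = \<i> * T s"
      unfolding T_def integral_mult_right[symmetric] by (simp add: mult_ac)
    ultimately show ?thesis by simp
  qed
  have parts: "\<i> * of_real r * poisson_int (s + 1) r = of_real (2 * (s + 1)) * T s"
    "\<i> * of_real r * T (s + 1) = of_real (2 * (s + 1)) * poisson_int s r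
       - of_real (2 * s + 3) * poisson_int (s + 1) r"
    unfolding T_def by (rule poisson_int_parts[OF s])+
  have "\<i> * T s = - of_real (r / (2 * (s + 1))) * poisson_int (s + 1) r"
  proof -
    have "complex_of_real (2 * (s + 1)) \<noteq> 0" using s by (simp del: of_real_mult of_real_add)
    then have "T s = \<i> * of_real r * poisson_int (s + 1) r / of_real (2 * (s + 1))"
      using parts(1) by (simp add: field_simps)
    then show ?thesis by (simp add: field_simps)
  qed
  then show "(poisson_int s has_vector_derivative - of_real (r / (2 * (s + 1))) * poisson_int (s + 1) r) (at r)"
    using der[OF s] by simp
  assume r: "r \<noteq> 0"
  have "\<i> * T (s + 1) = of_real (2 * (s + 1) / r) * poisson_int s r - of_real ((2 * s + 3) / r) * poisson_int (s + 1) r"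
  proof -
    have "\<i> * T (s + 1) = \<i> * of_real r * T (s + 1) / of_real r" using r by simp
    also have "\<dots> = of_real (2 * (s + 1) / r) * poisson_int s r - of_real ((2 * s + 3) / r) * poisson_int (s + 1) r"
      unfolding parts(2) by (simp add: diff_divide_distrib)
    finally show ?thesis .
  qed
  then show "(poisson_int (s + 1) has_vector_derivative
      of_real (2 * (s + 1) / r) * poisson_int s r - of_real ((2 * s + 3) / r) * poisson_int (s + 1) r) (at r)"
    using der[of "s + 1"] s by simp
qed

text \<open>The two classical recurrences, which stand in for Bessel's second order equation. The
  condition \<nu> > 1/2 makes the shifted order s = \<nu> - 1/2 positive, as the lemmas on the
  Poisson integral require.\<close>

lemma bessel_J_deriv:
  assumes \<nu>: "\<nu> > 1/2" and r: "r > 0"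
  shows "(bessel_J \<nu> has_vector_derivative of_real (\<nu> / r) * bessel_J \<nu> r - bessel_J (\<nu> + 1) r) (at r)"
    and "(bessel_J (\<nu> + 1) has_vector_derivative
           bessel_J \<nu> r - of_real ((\<nu> + 1) / r) * bessel_J (\<nu> + 1) r) (at r)"
proof -
  define c where "c = (\<lambda>\<nu>. 1 / (Gamma (\<nu> + 1/2) * sqrt pi))"
  have J: "bessel_J \<nu> = (\<lambda>r. of_real (c \<nu> * (r / 2) powr \<nu>) * poisson_int (\<nu> - 1/2) r)" for \<nu>
    by (auto simp: bessel_J_poisson_int c_def)
  \<comment> \<open>The functional equation of Gamma relates the normalizations of the orders \<nu>
    and \<nu> + 1.\<close>
  have c: "c \<nu> = (\<nu> + 1/2) * c (\<nu> + 1)"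
    using Gamma_plus1[of "\<nu> + 1/2"] \<nu> by (auto simp: c_def nonpos_Ints_def add_ac)
  have pw: "((\<lambda>r. complex_of_real (c \<nu> * (r / 2) powr \<nu>)) has_vector_derivative
      of_real (\<nu> / r * (c \<nu> * (r / 2) powr \<nu>))) (at r)" for \<nu>
  proof -
    have "((\<lambda>r. c \<nu> * (r / 2) powr \<nu>) has_real_derivative \<nu> / r * (c \<nu> * (r / 2) powr \<nu>)) (at r)"
      using r by (auto intro!: derivative_eq_intros simp: powr_diff field_simps)
    then show ?thesis
      using has_real_derivative_iff_has_vector_derivative has_vector_derivative_of_real by blast
  qed
  have s: "\<nu> + 1 - 1/2 = \<nu> - 1/2 + 1" by simp
  have pow: "(r / 2) powr (\<nu> + 1) = (r / 2) powr \<nu> * (r / 2)"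
    using r by (simp add: powr_add)
  have "(bessel_J \<nu> has_vector_derivative
      of_real (c \<nu> * (r / 2) powr \<nu>) * (- of_real (r / (2 * (\<nu> - 1/2 + 1))) * poisson_int (\<nu> - 1/2 + 1) r)
      + of_real (\<nu> / r * (c \<nu> * (r / 2) powr \<nu>)) * poisson_int (\<nu> - 1/2) r) (at r)"
    unfolding J by (intro has_vector_derivative_mult pw poisson_int_deriv) (use \<nu> in auto)
  moreover have "of_real (c \<nu> * (r / 2) powr \<nu>) * (- of_real (r / (2 * (\<nu> - 1/2 + 1))) * poisson_int (\<nu> - 1/2 + 1) r)
      = - bessel_J (\<nu> + 1) r"
  proof -
    have "c \<nu> * (r / 2) powr \<nu> * (r / (2 * (\<nu> - 1/2 + 1))) = c (\<nu> + 1) * (r / 2) powr (\<nu> + 1)"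
      using \<nu> unfolding pow c by (simp add: field_simps)
    moreover have m: "of_real x * (- of_real y * P) = - (of_real (x * y) * P)" for x y and P :: complex
      by simp
    ultimately show ?thesis
      unfolding J s m by simp
  qed
  ultimately show "(bessel_J \<nu> has_vector_derivative of_real (\<nu> / r) * bessel_J \<nu> r - bessel_J (\<nu> + 1) r) (at r)"
    by (simp add: J mult_ac)
  have "(bessel_J (\<nu> + 1) has_vector_derivative
      of_real (c (\<nu> + 1) * (r / 2) powr (\<nu> + 1)) * (of_real (2 * (\<nu> - 1/2 + 1) / r) * poisson_int (\<nu> - 1/2) r
         - of_real ((2 * (\<nu> - 1/2) + 3) / r) * poisson_int (\<nu> - 1/2 + 1) r)
      + of_real ((\<nu> + 1) / r * (c (\<nu> + 1) * (r / 2) powr (\<nu> + 1))) * poisson_int (\<nu> - 1/2 + 1) r) (at r)"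
    unfolding J s by (intro has_vector_derivative_mult pw poisson_int_deriv) (use \<nu> r in auto)
  moreover have "of_real (c (\<nu> + 1) * (r / 2) powr (\<nu> + 1)) * (of_real (2 * (\<nu> - 1/2 + 1) / r) * poisson_int (\<nu> - 1/2) r
         - of_real ((2 * (\<nu> - 1/2) + 3) / r) * poisson_int (\<nu> - 1/2 + 1) r)
      + of_real ((\<nu> + 1) / r * (c (\<nu> + 1) * (r / 2) powr (\<nu> + 1))) * poisson_int (\<nu> - 1/2 + 1) r
    = bessel_J \<nu> r - of_real ((\<nu> + 1) / r) * bessel_J (\<nu> + 1) r"
  proof -
    define u where "u = c (\<nu> + 1) * (r / 2) powr (\<nu> + 1)"
    have 1: "c \<nu> * (r / 2) powr \<nu> = u * (2 * (\<nu> - 1/2 + 1) / r)"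
      using r unfolding u_def pow c by (simp add: field_simps)
    show ?thesis
      unfolding J s 1 u_def[symmetric] using r by (simp add: field_simps)
  qed
  ultimately show "(bessel_J (\<nu> + 1) has_vector_derivative
           bessel_J \<nu> r - of_real ((\<nu> + 1) / r) * bessel_J (\<nu> + 1) r) (at r)"
    by simp
qed

section \<open>Contour deformation and asymptotics at infinity\<close>

lemma norm_powr_of_real_exponent:
  "w \<noteq> 0 \<Longrightarrow> norm (w powr complex_of_real s) = norm w powr s"
  by (simp add: powr_def)

lemma powr_of_real_mult_left:
  assumes "u > 0" "w \<noteq> 0"
  shows "(complex_of_real u * w) powr of_real s = of_real (u powr s) * w powr of_real s"
  using assms by (simp add: powr_def Ln_times_of_real Ln_of_real exp_add distrib_left flip: exp_of_real)

text \<open>The value of (u - 2i)^s at u = 0, which fixes the phase of the asymptotics: Ln (-i) = -i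
  pi / 2.\<close>

lemma minus_2i_powr: "(- 2 * \<i>) powr of_real s = of_real (2 powr s) * exp (- \<i> * of_real (pi * s / 2))"
proof -
  have "(- 2 * \<i>) powr of_real s = (of_real 2 * (- \<i>)) powr of_real s" by simp
  also have "\<dots> = of_real (2 powr s) * (- \<i>) powr of_real s"
    by (rule powr_of_real_mult_left) auto
  also have "(- \<i>) powr of_real s = exp (- \<i> * of_real (pi * s / 2))"
    by (simp add: powr_def field_simps)
  finally show ?thesis .
qed

text \<open>On z = 1 + i u one has 1 - z^2 = u (u - 2i), so i e^{ir} times this is the integral of
  e^{irz} (1 - z^2)^s over the segment from 1 to 1 + i.\<close>

definition hankel_int :: "real \<Rightarrow> real \<Rightarrow> complex" where
  "hankel_int s r = integral {0..1}
     (\<lambda>u. of_real (exp (- (r * u)) * u powr s) * (of_real u - 2 * \<i>) powr of_real s)"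

lemma continuous_on_hankel_factor:
  "continuous_on A (\<lambda>u::real. (of_real (c u) - 2 * \<i>) powr (of_real s :: complex))"
  if "continuous_on A c"
  using that by (intro continuous_intros) (auto simp: complex_eq_iff)

text \<open>The substitution v = r u moves r out of the exponential weight into the domain and the
  slowly varying factor.\<close>

lemma hankel_int_scaled:
  assumes r: "r > 0" and s: "s > 0"
  shows "((\<lambda>v. of_real (exp (- v) * v powr s) * (of_real (v / r) - 2 * \<i>) powr of_real s)
      has_integral of_real (r powr (s + 1)) * hankel_int s r) {0..r}"
proof -
  let ?g = "\<lambda>u. complex_of_real (exp (- (r * u)) * u powr s) * (of_real u - 2 * \<i>) powr of_real s"
  have "continuous_on {0..1} ?g"
    using s by (intro continuous_intros continuous_on_hankel_factor continuous_on_powr') auto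
  then have "(?g has_integral hankel_int s r) (cbox 0 1)"
    unfolding hankel_int_def cbox_interval by (intro integrable_integral integrable_continuous_interval)
  then have "((\<lambda>v. ?g ((1/r) *\<^sub>R v + 0)) has_integral (1 / (\<bar>1/r\<bar> ^ DIM(real))) *\<^sub>R hankel_int s r)
      ((\<lambda>x. (1 / (1/r)) *\<^sub>R x + - ((1 / (1/r)) *\<^sub>R 0)) ` cbox 0 1)"
    by (rule has_integral_affinity) (use r in auto)
  moreover have "(\<lambda>x. (1 / (1/r)) *\<^sub>R x + - ((1 / (1/r)) *\<^sub>R 0)) ` cbox 0 1 = {0..r}"
    using r by (simp add: image_mult_atLeastAtMost)
  ultimately have "((\<lambda>v. ?g (v / r)) has_integral of_real r * hankel_int s r) {0..r}"
    using r by (simp add: scaleR_conv_of_real)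
  then have "((\<lambda>v. of_real (r powr s) * ?g (v / r)) has_integral of_real (r powr s) * (of_real r * hankel_int s r)) {0..r}"
    by (rule has_integral_mult_right)
  also have "of_real (r powr s) * (of_real r * hankel_int s r) = of_real (r powr (s + 1)) * hankel_int s r"
    using r by (simp add: powr_add)
  finally show ?thesis
  proof (rule has_integral_eq[rotated])
    fix v assume "v \<in> {0..r}"
    then have "r powr s * (v / r) powr s = v powr s"
      using r by (simp flip: powr_mult)
    then have *: "complex_of_real (r powr s) * of_real ((v / r) powr s) = of_real (v powr s)"
      by (simp flip: of_real_mult)
    have "of_real (r powr s) * ?g (v / r) = (of_real (r powr s) * of_real ((v / r) powr s)) *
        (of_real (exp (- v)) * (of_real (v / r) - 2 * \<i>) powr of_real s)"
    proof -
      have "r * (v / r) = v" using r by simp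
      then show ?thesis by (simp only: of_real_mult mult_ac)
    qed
    then show "of_real (r powr s) * ?g (v / r) =
        of_real (exp (- v) * v powr s) * (of_real (v / r) - 2 * \<i>) powr of_real s"
      unfolding * by (simp only: of_real_mult mult_ac)
  qed
qed

text \<open>Leading term of Watson's lemma: after scaling, the integrand is dominated by 3^s v^s
  e^{-v} and tends pointwise to (-2i)^s v^s e^{-v}, whose integral is a Gamma value.\<close>

lemma hankel_int_tendsto:
  assumes s: "s > 0"
  shows "((\<lambda>r. of_real (r powr (s + 1)) * hankel_int s r) \<longlongrightarrow>
    of_real (Gamma (s + 1) * 2 powr s) * exp (- \<i> * of_real (pi * s / 2))) at_top"
proof (rule tendsto_at_topI_sequentially)
  fix X :: "nat \<Rightarrow> real" assume X: "filterlim X at_top sequentially"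
  then have "eventually (\<lambda>n. X n > 0) sequentially" by (simp add: filterlim_at_top_dense)
  then obtain N where N: "\<And>n. n \<ge> N \<Longrightarrow> X n > 0" by (auto simp: eventually_sequentially)
  \<comment> \<open>\<open>X\<close> is positive only eventually; the shifted sequence is positive
    throughout.\<close>
  define Y where "Y = (\<lambda>n. X (n + N))"
  have Y: "filterlim Y at_top sequentially" and Y_pos: "Y n > 0" for n
    unfolding Y_def using N by (simp_all add: filterlim_compose[OF X filterlim_add_const_nat_at_top])
  define f where "f = (\<lambda>n v. if v \<in> {0..Y n} then
      of_real (exp (- v) * v powr s) * (of_real (v / Y n) - 2 * \<i>) powr of_real s else (0::complex))"
  define g where "g = (\<lambda>v. of_real (exp (- v) * v powr s) * (- 2 * \<i>) powr of_real s :: complex)"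
  \<comment> \<open>The 3 bounds |v / Y - 2i| by 1 + 2 where 0 \<le> v \<le> Y, that is, where
    \<open>f n\<close> is not cut off.\<close>
  define w where "w = (\<lambda>v::real. (v powr s / exp v) * 3 powr s)"
  have f: "(f n has_integral of_real (Y n powr (s + 1)) * hankel_int s (Y n)) {0..}" for n
    unfolding f_def using hankel_int_scaled[OF Y_pos[of n] s]
    by (subst has_integral_restrict) auto
  have gam: "((\<lambda>v. v powr s / exp v) has_integral Gamma (s + 1)) {0..}"
    using Gamma_integral_real[of "s + 1"] s by simp
  have lim: "(\<lambda>n. integral {0..} (f n)) \<longlonglongrightarrow> integral {0..} g"
  proof (rule dominated_convergence(2))
    show "f n integrable_on {0..}" for n using f by (rule has_integral_integrable)
    show "w integrable_on {0..}"
      unfolding w_def using has_integral_mult_left[OF gam] by (rule has_integral_integrable)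
    show "norm (f n v) \<le> w v" if "v \<in> {0..}" for n v
    proof (cases "v \<in> {0..Y n}")
      case True
      have nz: "complex_of_real (v / Y n) - 2 * \<i> \<noteq> 0"
        by (auto simp: complex_eq_iff)
      have "norm (complex_of_real (v / Y n) - 2 * \<i>) \<le> norm (complex_of_real (v / Y n)) + norm (2 * \<i>)"
        by (rule norm_triangle_ineq4)
      also have "\<dots> \<le> 1 + 2" using True Y_pos[of n] by (simp add: norm_mult norm_divide)
      finally have "norm (complex_of_real (v / Y n) - 2 * \<i>) powr s \<le> 3 powr s"
        using s by (intro powr_mono2) auto
      then show ?thesis
        unfolding f_def w_def if_P[OF True] norm_mult norm_powr_of_real_exponent[OF nz] norm_of_real
        by (intro mult_mono) (auto simp: exp_minus divide_inverse mult.commute)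
    qed (auto simp: f_def w_def)
    show "(\<lambda>n. f n v) \<longlonglongrightarrow> g v" if "v \<in> {0..}" for v
    proof -
      have "(\<lambda>n. of_real (exp (- v) * v powr s) * (of_real (v / Y n) - 2 * \<i>) powr of_real s)
          \<longlonglongrightarrow> of_real (exp (- v) * v powr s) * (of_real 0 - 2 * \<i>) powr (of_real s :: complex)"
        by (intro tendsto_intros real_tendsto_divide_at_top[OF tendsto_const Y]) (auto simp: complex_nonpos_Reals_iff complex_nonneg_Reals_iff)
      moreover have "eventually (\<lambda>n. Y n \<ge> v) sequentially"
        using Y by (simp add: filterlim_at_top)
      then have "eventually (\<lambda>n. of_real (exp (- v) * v powr s) * (of_real (v / Y n) - 2 * \<i>) powr of_real s
          = f n v) sequentially"
        by eventually_elim (use that in \<open>auto simp: f_def\<close>)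
      ultimately show ?thesis
        unfolding g_def by (simp add: Lim_transform_eventually)
    qed
  qed
  have "((\<lambda>v. complex_of_real (v powr s / exp v) * (- 2 * \<i>) powr of_real s) has_integral
      of_real (Gamma (s + 1)) * (- 2 * \<i>) powr of_real s) {0..}"
    by (intro has_integral_mult_left has_integral_of_real gam)
  then have "(g has_integral of_real (Gamma (s + 1)) * (- 2 * \<i>) powr of_real s) {0..}"
    unfolding g_def by (simp add: exp_minus divide_inverse mult_ac)
  then have "integral {0..} g = of_real (Gamma (s + 1) * 2 powr s) * exp (- \<i> * of_real (pi * s / 2))"
    by (simp only: integral_unique minus_2i_powr of_real_mult mult.assoc)
  then have "(\<lambda>n. of_real (Y n powr (s + 1)) * hankel_int s (Y n)) \<longlonglongrightarrow>
      of_real (Gamma (s + 1) * 2 powr s) * exp (- \<i> * of_real (pi * s / 2))"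
    using lim by (simp only: integral_unique[OF f])
  then show "(\<lambda>n. of_real (X n powr (s + 1)) * hankel_int s (X n)) \<longlonglongrightarrow>
      of_real (Gamma (s + 1) * 2 powr s) * exp (- \<i> * of_real (pi * s / 2))"
    unfolding Y_def by (rule LIMSEQ_offset)
qed

text \<open>Cauchy's theorem on the rectangle with corners -1, 1, 1 + i, -1 + i. On the top side
  |e^{irz}| = e^{-r}; the vertical sides are mirror images under z -> - cnj z and yield
  \<open>hankel_int\<close> and its conjugate. The constant does not depend on r.\<close>

lemma poisson_int_contour:
  assumes s: "s > 0"
  obtains C where "\<And>r. norm (poisson_int s r -
    (\<i> * exp (- \<i> * of_real r) * cnj (hankel_int s r) - \<i> * exp (\<i> * of_real r) * hankel_int s r)) \<le> C * exp (- r)"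
proof -
  define p where "p = (\<lambda>z::complex. (1 - z\<^sup>2) powr of_real s)"
  define f where "f = (\<lambda>r z. exp (\<i> * of_real r * z) * p z)"
  define S where "S = cbox (- 1) (1 + \<i>)"
  have S: "z \<in> S \<longleftrightarrow> - 1 \<le> Re z \<and> Re z \<le> 1 \<and> 0 \<le> Im z \<and> Im z \<le> 1" for z
    by (auto simp: S_def in_cbox_complex_iff)
  \<comment> \<open>In the rectangle 1 - z^2 is real only if Re z = 0 or Im z = 0, and there it is
    nonnegative. The branch cut is met only in its end point 0, where s > 0 gives continuity of the
    power.\<close>
  have dom: "Re (1 - z\<^sup>2) \<ge> 0 \<or> Im (1 - z\<^sup>2) \<noteq> 0" if "z \<in> S" for z
  proof (cases "Im (1 - z\<^sup>2) = 0")
    case True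
    then have "Re z = 0 \<or> Im z = 0" by (auto simp: power2_eq_square)
    then have "Re (1 - z\<^sup>2) \<ge> 0"
    proof
      assume "Im z = 0"
      moreover have "(Re z)\<^sup>2 \<le> 1" using that by (auto simp: S abs_square_le_1 abs_le_iff)
      ultimately show ?thesis by (simp add: Re_power2)
    next
      assume "Re z = 0"
      then show ?thesis using zero_le_power2[of "Im z"] by (simp add: Re_power2 del: zero_le_power2)
    qed
    then show ?thesis ..
  qed auto
  have p_cont: "continuous_on S p"
    unfolding p_def using dom s by (intro continuous_intros) auto
  have f_cont: "continuous_on S (f r)" for r
    unfolding f_def by (intro continuous_intros p_cont)
  have "compact S" unfolding S_def by simp
  then have "bounded (p ` S)"
    using p_cont compact_continuous_image compact_imp_bounded by blast
  then obtain C where C: "C > 0" "\<And>z. z \<in> S \<Longrightarrow> norm (p z) \<le> C"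
    by (auto simp: bounded_pos)
  have conv: "convex S" unfolding S_def by simp
  have seg: "closed_segment a b \<subseteq> S" if "a \<in> S" "b \<in> S" for a b
    using that conv by (simp add: closed_segment_subset)
  have corners: "- 1 \<in> S" "1 \<in> S" "1 + \<i> \<in> S" "- 1 + \<i> \<in> S" by (auto simp: S)
  have int: "f r contour_integrable_on linepath a b" if "a \<in> S" "b \<in> S" for a b r
    using seg[OF that] f_cont continuous_on_subset
    by (intro contour_integrable_continuous_linepath) blast
  have "norm (poisson_int s r -
    (\<i> * exp (- \<i> * of_real r) * cnj (hankel_int s r) - \<i> * exp (\<i> * of_real r) * hankel_int s r)) \<le> (2 * C) * exp (- r)"
    for r
  proof -
    have "(f r has_contour_integral 0)
        (linepath (- 1) 1 +++ linepath 1 (1 + \<i>) +++ linepath (1 + \<i>) (- 1 + \<i>) +++ linepath (- 1 + \<i>) (- 1))"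
    proof (rule Cauchy_theorem_convex[OF f_cont conv])
      \<comment> \<open>Holomorphy holds on the open rectangle only: at the corners -1 and 1 the
        base 1 - z^2 vanishes.\<close>
      have "f r holomorphic_on box (- 1) (1 + \<i>)"
        unfolding f_def p_def
      proof (intro holomorphic_intros)
        fix x assume "x \<in> box (- 1) (1 + \<i>)"
        then have x: "- 1 < Re x" "Re x < 1" "0 < Im x"
          by (auto simp: in_box_complex_iff)
        show "1 - x\<^sup>2 \<notin> \<real>\<^sub>\<le>\<^sub>0"
        proof
          assume *: "1 - x\<^sup>2 \<in> \<real>\<^sub>\<le>\<^sub>0"
          then have "Re x = 0" using x by (auto simp: complex_nonpos_Reals_iff Im_power2)
          with * show False
            using zero_le_power2[of "Im x"]
            by (auto simp: complex_nonpos_Reals_iff Re_power2 simp del: zero_le_power2)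
        qed
      qed
      then show "f r field_differentiable at x" if "x \<in> interior S - {}" for x
        using that by (auto simp: S_def interior_cbox intro: holomorphic_on_imp_differentiable_at)
      show "path_image (linepath (- 1) 1 +++ linepath 1 (1 + \<i>) +++ linepath (1 + \<i>) (- 1 + \<i>) +++ linepath (- 1 + \<i>) (- 1)) \<subseteq> S"
        using seg corners by (simp add: path_image_join)
    qed auto
    then have sum0: "contour_integral (linepath (- 1) 1) (f r) + contour_integral (linepath 1 (1 + \<i>)) (f r)
        + contour_integral (linepath (1 + \<i>) (- 1 + \<i>)) (f r) + contour_integral (linepath (- 1 + \<i>) (- 1)) (f r) = 0"
      using int corners by (auto dest!: contour_integral_unique simp: contour_integrable_join add.assoc)
    have bottom: "contour_integral (linepath (- 1) 1) (f r) = poisson_int s r"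
    proof -
      have "contour_integral (linepath (- 1) 1) (f r) = integral {-1..1} (\<lambda>x. f r (of_real x))"
        using contour_integral_linepath_Reals_eq[of "-1" 1 "f r"] by simp
      also have "\<dots> = poisson_int s r"
        unfolding poisson_int_def
      proof (rule integral_cong)
        fix t :: real assume "t \<in> {-1..1}"
        then have "0 \<le> 1 - t\<^sup>2" by (simp add: abs_square_le_1 abs_le_iff)
        then have "p (of_real t) = of_real ((1 - t\<^sup>2) powr s)"
          using powr_of_real[of "1 - t\<^sup>2" s] by (simp add: p_def)
        then show "f r (of_real t) = exp (\<i> * of_real (r * t)) * of_real ((1 - t\<^sup>2) powr s)"
          by (simp add: f_def mult.assoc)
      qed
      finally show ?thesis .
    qed
    have right: "contour_integral (linepath 1 (1 + \<i>)) (f r) = \<i> * exp (\<i> * of_real r) * hankel_int s r"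
    proof -
      have "contour_integral (linepath 1 (1 + \<i>)) (f r) = integral {0..1} (\<lambda>u. f r (linepath 1 (1 + \<i>) u) * \<i>)"
        unfolding contour_integral_integral by simp
      also have "\<dots> = integral {0..1} (\<lambda>u. \<i> * exp (\<i> * of_real r) *
          (of_real (exp (- (r * u)) * u powr s) * (of_real u - 2 * \<i>) powr of_real s))"
      proof (rule integral_cong)
        fix u :: real assume u: "u \<in> {0..1}"
        have l: "linepath 1 (1 + \<i>) u = 1 + \<i> * of_real u"
          by (simp add: linepath_def scaleR_conv_of_real algebra_simps)
        have q: "1 - (1 + \<i> * of_real u)\<^sup>2 = of_real u * (of_real u - 2 * \<i>)"
          by (simp add: power2_eq_square algebra_simps)
        have "of_real u - 2 * \<i> \<noteq> 0" by (auto simp: complex_eq_iff)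
        then have pu: "p (1 + \<i> * of_real u) = of_real (u powr s) * (of_real u - 2 * \<i>) powr of_real s"
          unfolding p_def q using u s powr_of_real_mult_left[of u]
          by (cases "u = 0") auto
        have "\<i> * of_real r * (1 + \<i> * of_real u) = \<i> * of_real r + of_real (- (r * u))"
          by (simp add: algebra_simps)
        then have "exp (\<i> * of_real r * (1 + \<i> * of_real u)) = exp (\<i> * of_real r) * of_real (exp (- (r * u)))"
          by (simp only: exp_add exp_of_real)
        then show "f r (linepath 1 (1 + \<i>) u) * \<i> = \<i> * exp (\<i> * of_real r) *
          (of_real (exp (- (r * u)) * u powr s) * (of_real u - 2 * \<i>) powr of_real s)"
          unfolding l f_def pu by (simp add: mult_ac)
      qed
      finally show ?thesis by (simp only: hankel_int_def integral_mult_right)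
    qed
    have left: "contour_integral (linepath (- 1 + \<i>) (- 1)) (f r) = - (\<i> * exp (- \<i> * of_real r) * cnj (hankel_int s r))"
    proof -
      have "contour_integral (linepath (- 1 + \<i>) (- 1)) (f r) = - contour_integral (linepath (- 1) (- 1 + \<i>)) (f r)"
        by (rule contour_integral_reverse_linepath)
           (rule continuous_on_subset[OF f_cont seg[OF corners(4,1)]])
      also have "contour_integral (linepath (- 1) (- 1 + \<i>)) (f r) = integral {0..1} (\<lambda>u. f r (linepath (- 1) (- 1 + \<i>) u) * \<i>)"
        unfolding contour_integral_integral by simp
      also have "\<dots> = integral {0..1} (\<lambda>u. \<i> * exp (- \<i> * of_real r) *
          cnj (of_real (exp (- (r * u)) * u powr s) * (of_real u - 2 * \<i>) powr of_real s))"
      proof (rule integral_cong)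
        fix u :: real assume u: "u \<in> {0..1}"
        have l: "linepath (- 1) (- 1 + \<i>) u = - 1 + \<i> * of_real u"
          by (simp add: linepath_def scaleR_conv_of_real algebra_simps)
        have q: "1 - (- 1 + \<i> * of_real u)\<^sup>2 = of_real u * (of_real u + 2 * \<i>)"
          by (simp add: power2_eq_square algebra_simps)
        have nz: "of_real u + 2 * \<i> \<noteq> 0" by (auto simp: complex_eq_iff)
        then have pu: "p (- 1 + \<i> * of_real u) = of_real (u powr s) * (of_real u + 2 * \<i>) powr of_real s"
          unfolding p_def q using u s powr_of_real_mult_left[of u]
          by (cases "u = 0") auto
        \<comment> \<open>Conjugation commutes with the principal power because the base is off the
          negative real axis.\<close>
        have c: "cnj ((of_real u - 2 * \<i>) powr of_real s) = (of_real u + 2 * \<i>) powr of_real s"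
          using nz by (subst cnj_powr) (auto simp: complex_nonpos_Reals_iff complex_is_Real_iff)
        have "\<i> * of_real r * (- 1 + \<i> * of_real u) = - \<i> * of_real r + of_real (- (r * u))"
          by (simp add: algebra_simps)
        then have "exp (\<i> * of_real r * (- 1 + \<i> * of_real u)) = exp (- \<i> * of_real r) * of_real (exp (- (r * u)))"
          by (simp only: exp_add exp_of_real)
        then show "f r (linepath (- 1) (- 1 + \<i>) u) * \<i> = \<i> * exp (- \<i> * of_real r) *
          cnj (of_real (exp (- (r * u)) * u powr s) * (of_real u - 2 * \<i>) powr of_real s)"
          unfolding l f_def pu complex_cnj_mult c complex_cnj_complex_of_real
          by (simp add: mult_ac)
      qed
      finally show ?thesis unfolding hankel_int_def integral_cnj integral_mult_right .
    qed
    \<comment> \<open>The only side that is estimated rather than evaluated; its length is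
      2.\<close>
    have top: "norm (contour_integral (linepath (1 + \<i>) (- 1 + \<i>)) (f r)) \<le> (exp (- r) * C) * norm (- 1 + \<i> - (1 + \<i>))"
    proof (rule contour_integral_bound_linepath)
      fix x assume x: "x \<in> closed_segment (1 + \<i>) (- 1 + \<i>)"
      have "Im x = 1"
        using x by (auto simp: closed_segment_def)
      moreover have "norm (p x) \<le> C" using x seg corners C by blast
      ultimately show "norm (f r x) \<le> exp (- r) * C"
        by (simp add: f_def norm_mult)
    qed (use int corners C in auto)
    have "norm (- 1 + \<i> - (1 + \<i>)) = 2" by simp
    moreover have "poisson_int s r - (\<i> * exp (- \<i> * of_real r) * cnj (hankel_int s r) - \<i> * exp (\<i> * of_real r) * hankel_int s r)
       = - contour_integral (linepath (1 + \<i>) (- 1 + \<i>)) (f r)"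
      using sum0 unfolding bottom right left by (simp add: algebra_simps add_eq_0_iff2)
    ultimately show ?thesis using top by (simp add: mult_ac)
  qed
  then show ?thesis by (rule that)
qed

text \<open>The limit of the scaled \<open>hankel_int\<close> is inserted into the contour formula.
  The factors -i and i of the two vertical sides are quarter turns and change pi s / 2 into pi (s +
  1) / 2.\<close>

lemma poisson_int_asymp:
  assumes s: "s > 0"
  shows "((\<lambda>r. of_real (r powr (s + 1)) * poisson_int s r - of_real (Gamma (s + 1) * 2 powr s) *
    (exp (\<i> * of_real (r - pi * (s + 1) / 2)) + exp (- \<i> * of_real (r - pi * (s + 1) / 2)))) \<longlongrightarrow> 0) at_top"
proof -
  define c where "c = of_real (Gamma (s + 1) * 2 powr s) * exp (- \<i> * of_real (pi * s / 2))"
  define d where "d = (\<lambda>r. of_real (r powr (s + 1)) * hankel_int s r - c)"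
  obtain C where C: "\<And>r. norm (poisson_int s r -
    (\<i> * exp (- \<i> * of_real r) * cnj (hankel_int s r) - \<i> * exp (\<i> * of_real r) * hankel_int s r)) \<le> C * exp (- r)"
    using poisson_int_contour[OF s] by blast
  have d: "(d \<longlongrightarrow> 0) at_top"
    using tendsto_diff[OF hankel_int_tendsto[OF s] tendsto_const[of c]] by (simp add: d_def c_def)
  have c1: "- \<i> * exp (\<i> * of_real r) * c =
      of_real (Gamma (s + 1) * 2 powr s) * exp (\<i> * of_real (r - pi * (s + 1) / 2))"
    and c2: "\<i> * exp (- \<i> * of_real r) * cnj c =
      of_real (Gamma (s + 1) * 2 powr s) * exp (- \<i> * of_real (r - pi * (s + 1) / 2))" for r
  proof -
    have e0: "exp (\<i> * of_real (pi / 2)) = \<i>"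
      by (simp only: cis_conv_exp[symmetric] cis_pi_half)
    have "\<i> * of_real (r - pi * (s + 1) / 2) = - (\<i> * of_real (pi / 2)) + \<i> * of_real r + - \<i> * of_real (pi * s / 2)"
      "- \<i> * of_real (r - pi * (s + 1) / 2) = \<i> * of_real (pi / 2) + - \<i> * of_real r + \<i> * of_real (pi * s / 2)"
      by (simp_all add: field_simps)
    then have e: "exp (\<i> * of_real (r - pi * (s + 1) / 2)) = - \<i> * exp (\<i> * of_real r) * exp (- \<i> * of_real (pi * s / 2))"
      "exp (- \<i> * of_real (r - pi * (s + 1) / 2)) = \<i> * exp (- \<i> * of_real r) * exp (\<i> * of_real (pi * s / 2))"
      using e0 by (simp_all only: exp_add exp_minus) simp_all
    show "- \<i> * exp (\<i> * of_real r) * c =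
      of_real (Gamma (s + 1) * 2 powr s) * exp (\<i> * of_real (r - pi * (s + 1) / 2))"
      unfolding e c_def by (simp only: mult_ac)
    have "cnj c = of_real (Gamma (s + 1) * 2 powr s) * exp (\<i> * of_real (pi * s / 2))"
      by (simp add: c_def exp_cnj)
    then show "\<i> * exp (- \<i> * of_real r) * cnj c =
      of_real (Gamma (s + 1) * 2 powr s) * exp (- \<i> * of_real (r - pi * (s + 1) / 2))"
      unfolding e by (simp only: mult_ac)
  qed
  have bound: "norm (of_real (r powr (s + 1)) * poisson_int s r - of_real (Gamma (s + 1) * 2 powr s) *
    (exp (\<i> * of_real (r - pi * (s + 1) / 2)) + exp (- \<i> * of_real (r - pi * (s + 1) / 2))))
    \<le> C * (r powr (s + 1) * exp (- r)) + 2 * norm (d r)" for r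
  proof -
    define E where "E = poisson_int s r -
      (\<i> * exp (- \<i> * of_real r) * cnj (hankel_int s r) - \<i> * exp (\<i> * of_real r) * hankel_int s r)"
    have P: "poisson_int s r = E + (\<i> * exp (- \<i> * of_real r) * cnj (hankel_int s r) - \<i> * exp (\<i> * of_real r) * hankel_int s r)"
      by (simp add: E_def)
    have g: "of_real (Gamma (s + 1) * 2 powr s) *
      (exp (\<i> * of_real (r - pi * (s + 1) / 2)) + exp (- \<i> * of_real (r - pi * (s + 1) / 2)))
      = - \<i> * exp (\<i> * of_real r) * c + \<i> * exp (- \<i> * of_real r) * cnj c"
      unfolding c1 c2 by (rule distrib_left)
    have "of_real (r powr (s + 1)) * poisson_int s r - of_real (Gamma (s + 1) * 2 powr s) *
      (exp (\<i> * of_real (r - pi * (s + 1) / 2)) + exp (- \<i> * of_real (r - pi * (s + 1) / 2)))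
      = of_real (r powr (s + 1)) * E + \<i> * exp (- \<i> * of_real r) * cnj (d r) - \<i> * exp (\<i> * of_real r) * d r"
      unfolding g P d_def by (simp add: algebra_simps)
    also have "norm \<dots> \<le> norm (of_real (r powr (s + 1)) * E) + norm (\<i> * exp (- \<i> * of_real r) * cnj (d r))
        + norm (\<i> * exp (\<i> * of_real r) * d r)"
      by (intro order_trans[OF norm_triangle_ineq4] add_mono norm_triangle_ineq order_refl)
    also have "\<dots> = r powr (s + 1) * norm E + 2 * norm (d r)"
      by (simp add: norm_mult)
    also have "\<dots> \<le> r powr (s + 1) * (C * exp (- r)) + 2 * norm (d r)"
      using C[of r] by (intro add_mono mult_left_mono) (auto simp: E_def)
    finally show ?thesis by (simp add: mult_ac)
  qed
  \<comment> \<open>The exponentially small top side stays negligible after multiplication by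
    r^{s+1}.\<close>
  have pw: "((\<lambda>r::real. r powr (s + 1) * exp (- r)) \<longlongrightarrow> 0) at_top"
    using s by real_asymp
  have "((\<lambda>r. C * (r powr (s + 1) * exp (- r)) + 2 * norm (d r)) \<longlongrightarrow> C * 0 + 2 * norm (0::complex)) at_top"
    by (intro tendsto_intros pw d)
  then show ?thesis
    by (intro Lim_null_comparison[OF eventuallyI[OF bound]]) simp
qed

section \<open>Large-argument asymptotics of the Bessel function\<close>

definition hankel_phase :: "real \<Rightarrow> real \<Rightarrow> real" where
  "hankel_phase \<nu> r = r - pi * \<nu> / 2 - pi / 4"

text \<open>The order is fixed and no uniformity in \<nu> is claimed: this supplies the initial data
  at p = 0 for the energy argument.\<close>

lemma bessel_J_asymp:
  assumes \<nu>: "\<nu> > 1/2"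
  shows "((\<lambda>r. of_real (sqrt r) * bessel_J \<nu> r - of_real (1 / sqrt (2 * pi)) *
    (exp (\<i> * of_real (hankel_phase \<nu> r)) + exp (- \<i> * of_real (hankel_phase \<nu> r)))) \<longlongrightarrow> 0) at_top"
proof -
  define s where "s = \<nu> - 1/2"
  have s: "s > 0" using \<nu> by (simp add: s_def)
  define c where "c = 1 / (2 powr \<nu> * Gamma (s + 1) * sqrt pi)"
  have G: "Gamma (s + 1) > 0" using s by (intro Gamma_real_pos) auto
  have "((\<lambda>r. of_real c * (of_real (r powr (s + 1)) * poisson_int s r - of_real (Gamma (s + 1) * 2 powr s) *
    (exp (\<i> * of_real (r - pi * (s + 1) / 2)) + exp (- \<i> * of_real (r - pi * (s + 1) / 2))))) \<longlongrightarrow> of_real c * 0) at_top"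
    by (intro tendsto_intros poisson_int_asymp s)
  moreover have "eventually (\<lambda>r. of_real c * (of_real (r powr (s + 1)) * poisson_int s r - of_real (Gamma (s + 1) * 2 powr s) *
    (exp (\<i> * of_real (r - pi * (s + 1) / 2)) + exp (- \<i> * of_real (r - pi * (s + 1) / 2))))
    = of_real (sqrt r) * bessel_J \<nu> r - of_real (1 / sqrt (2 * pi)) *
    (exp (\<i> * of_real (hankel_phase \<nu> r)) + exp (- \<i> * of_real (hankel_phase \<nu> r)))) at_top"
    using eventually_gt_at_top[of 0]
  proof eventually_elim
    case (elim r)
    have ph: "r - pi * (s + 1) / 2 = hankel_phase \<nu> r"
      by (simp add: s_def hankel_phase_def field_simps)
    have "c * r powr (s + 1) = sqrt r * ((r / 2) powr \<nu> / (Gamma (\<nu> + 1/2) * sqrt pi))"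
    proof -
      have e: "s + 1 = \<nu> + 1/2" by (simp add: s_def)
      show ?thesis
        using elim unfolding c_def e by (simp add: powr_add powr_divide powr_half_sqrt mult_ac)
    qed
    then have 1: "of_real c * (of_real (r powr (s + 1)) * poisson_int s r) = of_real (sqrt r) * bessel_J \<nu> r"
      unfolding bessel_J_poisson_int s_def[symmetric]
      by (simp only: mult.assoc[symmetric] of_real_mult[symmetric])
    \<comment> \<open>2^s / 2^\<nu> = 2^{-1/2}, and the Gamma factor of the asymptotics cancels the
      one in the normalization.\<close>
    have "c * (Gamma (s + 1) * 2 powr s) = 1 / sqrt (2 * pi)"
      using G unfolding c_def s_def by (simp add: powr_diff powr_half_sqrt real_sqrt_mult)
    then have 2: "of_real c * (of_real (Gamma (s + 1) * 2 powr s) * x) = of_real (1 / sqrt (2 * pi)) * x"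
      for x :: complex
      by (simp only: mult.assoc[symmetric] of_real_mult[symmetric])
    show ?case unfolding right_diff_distrib 1 2 ph ..
  qed
  ultimately show ?thesis by (simp add: Lim_transform_eventually)
qed

section \<open>WKB approximation\<close>

text \<open>\<open>wkb_r\<close> inverts \<open>r \<mapsto> p = \<nu> / \<surd>(r\<^sup>2 - \<nu>\<^sup>2)\<close>, and \<open>wkb_K\<close> is \<open>r J\<^sub>\<nu>'(r)\<close>, rewritten by the recurrence.\<close>
definition wkb_r :: "real \<Rightarrow> real \<Rightarrow> real" where
  "wkb_r \<nu> p = \<nu> * sqrt (1 + 1 / p\<^sup>2)"

text \<open>Since \<nu> / p = sqrt (r^2 - \<nu>^2), the prefactor is (r^2 - \<nu>^2)^{1/4} and
  compensates the decay of the WKB amplitude.\<close>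

definition wkb_W :: "real \<Rightarrow> real \<Rightarrow> complex" where
  "wkb_W \<nu> p = of_real (sqrt (\<nu> / p)) * bessel_J \<nu> (wkb_r \<nu> p)"

definition wkb_K :: "real \<Rightarrow> real \<Rightarrow> complex" where
  "wkb_K \<nu> p = of_real \<nu> * bessel_J \<nu> (wkb_r \<nu> p) - of_real (wkb_r \<nu> p) * bessel_J (\<nu> + 1) (wkb_r \<nu> p)"

text \<open>This is - W' / \<kappa>; the term with (1 + p^2) / 2 comes from differentiating the
  prefactor sqrt (\<nu> / p).\<close>

definition wkb_V :: "real \<Rightarrow> real \<Rightarrow> complex" where
  "wkb_V \<nu> p = of_real (sqrt (\<nu> / p) * p / \<nu>) *
     (of_real ((1 + p\<^sup>2) / 2) * bessel_J \<nu> (wkb_r \<nu> p) + wkb_K \<nu> p)"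

lemma wkb_r_pos: "\<nu> > 0 \<Longrightarrow> wkb_r \<nu> p > 0"
  unfolding wkb_r_def by (intro mult_pos_pos) (auto intro: add_pos_nonneg)

lemma wkb_r_square: "p > 0 \<Longrightarrow> (wkb_r \<nu> p)\<^sup>2 = \<nu>\<^sup>2 * (1 + p\<^sup>2) / p\<^sup>2"
  by (simp add: wkb_r_def power_mult_distrib field_simps)

lemma wkb_r_deriv:
  assumes "\<nu> > 0" "p > 0"
  shows "(wkb_r \<nu> has_real_derivative - \<nu>\<^sup>2 / (p ^ 3 * wkb_r \<nu> p)) (at p)"
proof -
  have pos: "1 + 1 / p\<^sup>2 > 0" by (intro add_pos_nonneg) auto
  have "((\<lambda>p. 1 + 1 / p\<^sup>2) has_real_derivative - 2 / p ^ 3) (at p)"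
    using assms by (auto intro!: derivative_eq_intros simp: field_simps power_numeral_reduce)
  from DERIV_cmult[OF DERIV_chain2[OF DERIV_real_sqrt[OF pos] this], of \<nu>]
  show ?thesis
    unfolding wkb_r_def using assms by (simp add: field_simps power2_eq_square)
qed

text \<open>Here a = sqrt (\<nu> / p), j is the Bessel function, k is r times its derivative, and q
  = 1 + p^2 is kept as an atom. In the second identity all terms with k cancel, so V' is a multiple
  of W alone.\<close>

lemma wkb_system_algebra:
  fixes P N q a j k :: complex
  assumes nz: "P \<noteq> 0" "N \<noteq> 0" "q \<noteq> 0"
  shows "a * (- k / (P * q)) + - a / (2 * P) * j = - (N / (P\<^sup>2 * q)) * (a * P / N * (q / 2 * j + k))"
    and "a * (P / N * ((q / 2 * (- k / (P * q)) + P * j) + N\<^sup>2 / (P ^ 3 * q) * j) + 1 / N * (q / 2 * j + k))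
       + - a / (2 * P) * (P / N * (q / 2 * j + k)) = (N / (P\<^sup>2 * q) + (q + 4 * P\<^sup>2) / (4 * N)) * (a * j)"
proof -
  have 1: "- (N / (P\<^sup>2 * q)) * (a * P / N * (q / 2 * j + k)) = - a / (P * q) * (q / 2 * j + k)"
    using nz by (simp add: power2_eq_square)
  have 2: "a / (P * q) * (q / 2 * j) = a / (2 * P) * j"
    using nz by simp
  show "a * (- k / (P * q)) + - a / (2 * P) * j = - (N / (P\<^sup>2 * q)) * (a * P / N * (q / 2 * j + k))"
    unfolding 1 using 2 by (simp add: distrib_left)
  have 3: "P / N * (q / 2 * (- k / (P * q))) = - k / (2 * N)" "P / N * (N\<^sup>2 / (P ^ 3 * q) * j) = N / (P\<^sup>2 * q) * j"
    "- a / (2 * P) * (P / N * (q / 2 * j + k)) = - a / (2 * N) * (q / 2 * j + k)"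
    using nz by (simp_all add: power_numeral_reduce)
  show "a * (P / N * ((q / 2 * (- k / (P * q)) + P * j) + N\<^sup>2 / (P ^ 3 * q) * j) + 1 / N * (q / 2 * j + k))
       + - a / (2 * P) * (P / N * (q / 2 * j + k)) = (N / (P\<^sup>2 * q) + (q + 4 * P\<^sup>2) / (4 * N)) * (a * j)"
    unfolding distrib_left[of "P / N"] 3 using nz
    by (simp add: algebra_simps power2_eq_square add_divide_distrib)
qed

lemma wkb_system:
  assumes \<nu>: "\<nu> > 1/2" and p: "p > 0"
  shows "(wkb_W \<nu> has_vector_derivative - of_real (\<nu> / (p\<^sup>2 * (1 + p\<^sup>2))) * wkb_V \<nu> p) (at p)"
    and "(wkb_V \<nu> has_vector_derivative
      of_real (\<nu> / (p\<^sup>2 * (1 + p\<^sup>2)) + (1 + 5 * p\<^sup>2) / (4 * \<nu>)) * wkb_W \<nu> p) (at p)"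
proof -
  define r where "r = wkb_r \<nu> p"
  define A where "A = (\<lambda>p. complex_of_real (sqrt (\<nu> / p)))"
  define J where "J = (\<lambda>\<nu>' p. bessel_J \<nu>' (wkb_r \<nu> p))"
  define P where "P = complex_of_real p"
  define N where "N = complex_of_real \<nu>"
  have r: "r > 0" using \<nu> by (simp add: r_def wkb_r_pos)
  have r2: "r\<^sup>2 = \<nu>\<^sup>2 * (1 + p\<^sup>2) / p\<^sup>2" using p by (simp add: r_def wkb_r_square)
  have p2: "1 + p\<^sup>2 > 0" by (intro add_pos_nonneg) auto
  have nz: "P \<noteq> 0" "N \<noteq> 0" "1 + P\<^sup>2 \<noteq> 0" "complex_of_real r \<noteq> 0"
  proof -
    have "1 + P\<^sup>2 = of_real (1 + p\<^sup>2)" by (simp add: P_def)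
    then show "1 + P\<^sup>2 \<noteq> 0" using p2 by (simp only: of_real_eq_0_iff)
  qed (use p \<nu> r in \<open>auto simp: P_def N_def\<close>)
  have R2: "(complex_of_real r)\<^sup>2 = N\<^sup>2 * (1 + P\<^sup>2) / P\<^sup>2"
    using arg_cong[OF r2, of complex_of_real] by (simp add: N_def P_def)
  have A': "(A has_vector_derivative - A p / (2 * P)) (at p)"
  proof -
    have "((\<lambda>p. sqrt (\<nu> / p)) has_real_derivative - sqrt (\<nu> / p) / (2 * p)) (at p)"
      using p \<nu> by (auto intro!: derivative_eq_intros simp: real_sqrt_divide field_simps power2_eq_square)
    from has_vector_derivative_of_real[OF this, where ?'a = complex] show ?thesis
      by (simp add: A_def P_def)
  qed
  have r': "(wkb_r \<nu> has_real_derivative - \<nu>\<^sup>2 / (p ^ 3 * r)) (at p)"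
    unfolding r_def using \<nu> p by (intro wkb_r_deriv) auto
  define c where "c = complex_of_real (- \<nu>\<^sup>2 / (p ^ 3 * r))"
  have c: "c = - N\<^sup>2 / (P ^ 3 * of_real r)" by (simp add: c_def N_def P_def)
  have r'': "((\<lambda>p. complex_of_real (wkb_r \<nu> p)) has_vector_derivative c) (at p)"
    unfolding c_def by (intro has_vector_derivative_of_real r')
  have chain: "((\<lambda>p. f (wkb_r \<nu> p)) has_vector_derivative c * f') (at p)"
    if "(f has_vector_derivative f') (at r)" for f :: "real \<Rightarrow> complex" and f'
    using vector_diff_chain_at[of "wkb_r \<nu>" "- \<nu>\<^sup>2 / (p ^ 3 * r)" p f f'] r' that
    by (simp add: o_def r_def c_def scaleR_conv_of_real has_real_derivative_iff_has_vector_derivative)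
  have J1: "(J \<nu> has_vector_derivative c * (N / of_real r * J \<nu> p - J (\<nu> + 1) p)) (at p)"
    using chain[OF bessel_J_deriv(1)[OF \<nu> r]] by (simp add: J_def r_def N_def)
  have J2: "(J (\<nu> + 1) has_vector_derivative c * (J \<nu> p - (N + 1) / of_real r * J (\<nu> + 1) p)) (at p)"
    using chain[OF bessel_J_deriv(2)[OF \<nu> r]] by (simp add: J_def r_def N_def)
  have K: "wkb_K \<nu> = (\<lambda>p. N * J \<nu> p - of_real (wkb_r \<nu> p) * J (\<nu> + 1) p)"
    by (auto simp: wkb_K_def J_def N_def)
  have W: "wkb_W \<nu> = (\<lambda>p. A p * J \<nu> p)"
    by (auto simp: wkb_W_def J_def A_def)
  have V: "wkb_V \<nu> = (\<lambda>p. A p * (of_real p / N * (of_real ((1 + p\<^sup>2) / 2) * J \<nu> p + wkb_K \<nu> p)))"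
    by (auto simp: wkb_V_def J_def A_def N_def mult_ac)
  have Vp: "wkb_V \<nu> p = A p * P / N * ((1 + P\<^sup>2) / 2 * J \<nu> p + wkb_K \<nu> p)"
    by (simp add: V P_def)
  have j': "(J \<nu> has_vector_derivative - wkb_K \<nu> p / (P * (1 + P\<^sup>2))) (at p)"
  proof -
    have "c * (N / of_real r * J \<nu> p - J (\<nu> + 1) p) = - (N\<^sup>2 / (P ^ 3 * (of_real r)\<^sup>2)) * wkb_K \<nu> p"
      using nz unfolding c K r_def[symmetric] by (simp add: field_simps power2_eq_square)
    also have "N\<^sup>2 / (P ^ 3 * (of_real r)\<^sup>2) = 1 / (P * (1 + P\<^sup>2))"
    proof -
      define q where "q = 1 + P\<^sup>2"
      have "q \<noteq> 0" using nz by (simp add: q_def)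
      then show ?thesis
        unfolding R2 q_def[symmetric] using nz by (simp add: field_simps power_numeral_reduce)
    qed
    finally show ?thesis using J1 by simp
  qed
  \<comment> \<open>Bessel's equation in self-adjoint form, (r J')' = (\<nu>^2 / r - r) J, times
    dr/dp, simplified by 1 - \<nu>^2 / r^2 = 1 / (1 + p^2).\<close>
  have K': "(wkb_K \<nu> has_vector_derivative N\<^sup>2 / (P ^ 3 * (1 + P\<^sup>2)) * J \<nu> p) (at p)"
  proof -
    have "(wkb_K \<nu> has_vector_derivative N * (c * (N / of_real r * J \<nu> p - J (\<nu> + 1) p)) -
        (of_real r * (c * (J \<nu> p - (N + 1) / of_real r * J (\<nu> + 1) p)) + c * J (\<nu> + 1) p)) (at p)"
      unfolding K r_def
      by (intro has_vector_derivative_diff has_vector_derivative_mult_right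
          has_vector_derivative_mult[OF r''] J1[unfolded r_def] J2[unfolded r_def])
    moreover have "N * (c * (N / of_real r * J \<nu> p - J (\<nu> + 1) p)) -
        (of_real r * (c * (J \<nu> p - (N + 1) / of_real r * J (\<nu> + 1) p)) + c * J (\<nu> + 1) p)
        = c * (N\<^sup>2 / of_real r - of_real r) * J \<nu> p"
      using nz by (simp add: field_simps power2_eq_square)
    moreover have "c * (N\<^sup>2 / of_real r - of_real r) = N\<^sup>2 / P ^ 3 * (1 - N\<^sup>2 / (of_real r)\<^sup>2)"
      using nz unfolding c by (simp add: field_simps power2_eq_square)
    moreover have "N\<^sup>2 / P ^ 3 * (1 - N\<^sup>2 / (of_real r)\<^sup>2) = N\<^sup>2 / (P ^ 3 * (1 + P\<^sup>2))"
    proof -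
      have "1 - N\<^sup>2 / (of_real r)\<^sup>2 = 1 / (1 + P\<^sup>2)"
        unfolding R2 using nz by (simp add: divide_simps)
      then show ?thesis by simp
    qed
    ultimately show ?thesis by (simp only:)
  qed
  have "(wkb_W \<nu> has_vector_derivative A p * (- wkb_K \<nu> p / (P * (1 + P\<^sup>2))) + - A p / (2 * P) * J \<nu> p) (at p)"
    unfolding W by (intro has_vector_derivative_mult A' j')
  moreover have "A p * (- wkb_K \<nu> p / (P * (1 + P\<^sup>2))) + - A p / (2 * P) * J \<nu> p
      = - of_real (\<nu> / (p\<^sup>2 * (1 + p\<^sup>2))) * wkb_V \<nu> p"
  proof -
    have "complex_of_real (\<nu> / (p\<^sup>2 * (1 + p\<^sup>2))) = N / (P\<^sup>2 * (1 + P\<^sup>2))"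
      by (simp add: N_def P_def)
    then show ?thesis
      unfolding Vp using wkb_system_algebra(1)[OF nz(1-3)] by (simp only:)
  qed
  ultimately show "(wkb_W \<nu> has_vector_derivative - of_real (\<nu> / (p\<^sup>2 * (1 + p\<^sup>2))) * wkb_V \<nu> p) (at p)"
    by simp
  have h': "((\<lambda>p. complex_of_real ((1 + p\<^sup>2) / 2)) has_vector_derivative P) (at p)"
  proof -
    have "((\<lambda>p. (1 + p\<^sup>2) / 2) has_real_derivative p) (at p)"
      by (auto intro!: derivative_eq_intros)
    then show ?thesis unfolding P_def by (rule has_vector_derivative_of_real)
  qed
  have q': "((\<lambda>p. complex_of_real p / N) has_vector_derivative 1 / N) (at p)"
    using has_vector_derivative_divide[OF has_vector_derivative_of_real[OF DERIV_ident, where ?'a = complex]]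
    by simp
  have "(wkb_V \<nu> has_vector_derivative A p * (P / N * ((of_real ((1 + p\<^sup>2) / 2) * (- wkb_K \<nu> p / (P * (1 + P\<^sup>2))) + P * J \<nu> p)
       + N\<^sup>2 / (P ^ 3 * (1 + P\<^sup>2)) * J \<nu> p) + 1 / N * (of_real ((1 + p\<^sup>2) / 2) * J \<nu> p + wkb_K \<nu> p))
       + - A p / (2 * P) * (P / N * (of_real ((1 + p\<^sup>2) / 2) * J \<nu> p + wkb_K \<nu> p))) (at p)"
    unfolding V P_def[symmetric]
    using has_vector_derivative_mult[OF A' has_vector_derivative_mult[OF q'
      has_vector_derivative_add[OF has_vector_derivative_mult[OF h' j'] K']]]
    by (simp only: P_def)
  moreover have "A p * (P / N * ((of_real ((1 + p\<^sup>2) / 2) * (- wkb_K \<nu> p / (P * (1 + P\<^sup>2))) + P * J \<nu> p)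
       + N\<^sup>2 / (P ^ 3 * (1 + P\<^sup>2)) * J \<nu> p) + 1 / N * (of_real ((1 + p\<^sup>2) / 2) * J \<nu> p + wkb_K \<nu> p))
       + - A p / (2 * P) * (P / N * (of_real ((1 + p\<^sup>2) / 2) * J \<nu> p + wkb_K \<nu> p))
     = of_real (\<nu> / (p\<^sup>2 * (1 + p\<^sup>2)) + (1 + 5 * p\<^sup>2) / (4 * \<nu>)) * wkb_W \<nu> p"
  proof -
    have 1: "complex_of_real (\<nu> / (p\<^sup>2 * (1 + p\<^sup>2)) + (1 + 5 * p\<^sup>2) / (4 * \<nu>)) = N / (P\<^sup>2 * (1 + P\<^sup>2)) + (1 + 5 * P\<^sup>2) / (4 * N)"
      by (simp add: N_def P_def)
    have 2: "complex_of_real ((1 + p\<^sup>2) / 2) = (1 + P\<^sup>2) / 2" by (simp add: P_def)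
    have 3: "1 + 5 * P\<^sup>2 = (1 + P\<^sup>2) + 4 * P\<^sup>2" by simp
    show ?thesis
      unfolding 1 2 3 W by (rule wkb_system_algebra(2)[OF nz(1-3)])
  qed
  ultimately show "(wkb_V \<nu> has_vector_derivative
      of_real (\<nu> / (p\<^sup>2 * (1 + p\<^sup>2)) + (1 + 5 * p\<^sup>2) / (4 * \<nu>)) * wkb_W \<nu> p) (at p)"
    by simp
qed

section \<open>Approximate solutions of the system\<close>

definition wkb_phase :: "real \<Rightarrow> real \<Rightarrow> real" where
  "wkb_phase \<nu> p = \<nu> * (1 / p - arctan (1 / p)) - pi / 4"

definition wkb_poly :: "nat \<Rightarrow> real \<Rightarrow> complex poly" where
  "wkb_poly n \<nu> = (\<Sum>k\<le>n. smult (1 / of_real \<nu> ^ k) (debye k))"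

definition wkb_Y :: "nat \<Rightarrow> real \<Rightarrow> real \<Rightarrow> complex" where
  "wkb_Y n \<nu> p = exp (\<i> * of_real (wkb_phase \<nu> p)) * poly (wkb_poly n \<nu>) (of_real p)"

text \<open>Forced by Y' = - \<kappa> X, since the phase has derivative - \<kappa> and 1 / \<kappa>
  = p^2 (1 + p^2) / \<nu>.\<close>

definition wkb_X :: "nat \<Rightarrow> real \<Rightarrow> real \<Rightarrow> complex" where
  "wkb_X n \<nu> p = exp (\<i> * of_real (wkb_phase \<nu> p)) *
     (\<i> * poly (wkb_poly n \<nu>) (of_real p) - poly ([:0, 0, 1, 0, 1:] * pderiv (wkb_poly n \<nu>)) (of_real p) / of_real \<nu>)"

text \<open>The left side is the defect of the ansatz with the phase factored out. By
  \<open>pderiv_debye_Suc\<close> the contribution of order k to the second part cancels that of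
  order k + 1 to the first; only the last order stays unmatched.\<close>

lemma wkb_poly_residual:
  assumes "\<nu> \<noteq> 0"
  shows "smult (2 * \<i>) (pderiv (wkb_poly n \<nu>)) - smult (1 / of_real \<nu>)
      (pderiv ([:0, 0, 1, 0, 1:] * pderiv (wkb_poly n \<nu>)) + [:1/4, 0, 5/4:] * wkb_poly n \<nu>)
    = - smult (2 * \<i> / of_real \<nu> ^ Suc n) (pderiv (debye (Suc n)))"
proof (induction n)
  case 0
  have "pderiv (wkb_poly 0 \<nu>) = 0" by (simp add: wkb_poly_def)
  moreover have "wkb_poly 0 \<nu> = debye 0" by (simp add: wkb_poly_def)
  moreover have "smult (2 * \<i> / of_real \<nu> ^ Suc 0) (pderiv (debye (Suc 0)))
      = smult (1 / of_real \<nu>) (smult (2 * \<i>) (pderiv (debye (Suc 0))))"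
    by simp
  ultimately show ?case
    unfolding pderiv_debye_Suc by simp
next
  case (Suc n)
  define c where "c = 1 / complex_of_real \<nu> ^ Suc n"
  have split: "wkb_poly (Suc n) \<nu> = wkb_poly n \<nu> + smult c (debye (Suc n))"
    by (simp add: wkb_poly_def c_def)
  define B where "B = (\<lambda>Z. pderiv ([:0, 0, 1, 0, 1:] * pderiv Z) + [:1/4, 0, 5/4:] * Z :: complex poly)"
  have B: "B Z = pderiv ([:0, 0, 1, 0, 1:] * pderiv Z) + [:1/4, 0, 5/4:] * Z" for Z
    unfolding B_def ..
  have B_add: "B (x + smult c y) = B x + smult c (B y)" for x y
  proof -
    have "pderiv (f * pderiv (x + smult c y)) + g * (x + smult c y)
      = pderiv (f * pderiv x) + g * x + smult c (pderiv (f * pderiv y) + g * y)" for f g :: "complex poly"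
      by (simp only: pderiv_add pderiv_smult distrib_left mult_smult_right smult_add_right ac_simps)
    then show ?thesis unfolding B_def .
  qed
  have B_debye: "B (debye (Suc n)) = smult (2 * \<i>) (pderiv (debye (Suc (Suc n))))"
    unfolding B_def by (rule pderiv_debye_Suc[symmetric])
  have cc: "1 / of_real \<nu> * (c * (2 * \<i>)) = 2 * \<i> / of_real \<nu> ^ Suc (Suc n)"
    by (simp add: c_def)
  have "smult (2 * \<i>) (pderiv (wkb_poly (Suc n) \<nu>)) - smult (1 / of_real \<nu>) (B (wkb_poly (Suc n) \<nu>))
    = (smult (2 * \<i>) (pderiv (wkb_poly n \<nu>)) - smult (1 / of_real \<nu>) (B (wkb_poly n \<nu>)))
      + smult (2 * \<i> * c) (pderiv (debye (Suc n)))
      - smult (1 / of_real \<nu> * (c * (2 * \<i>))) (pderiv (debye (Suc (Suc n))))"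
    unfolding split B_add B_debye pderiv_add pderiv_smult smult_add_right smult_smult
    by simp
  also have "\<dots> = - smult (2 * \<i> / of_real \<nu> ^ Suc (Suc n)) (pderiv (debye (Suc (Suc n))))"
    unfolding Suc.IH[folded B] cc by (simp add: c_def)
  finally show ?case by (simp only: B_def)
qed

lemma has_vector_derivative_poly_of_real:
  "((\<lambda>x. poly f (complex_of_real x)) has_vector_derivative poly (pderiv f) (of_real x)) (at x)"
  by (rule has_vector_derivative_real_field[OF poly_DERIV])

lemma wkb_phase_deriv:
  assumes "p > 0"
  shows "((\<lambda>p. exp (\<i> * of_real (wkb_phase \<nu> p))) has_vector_derivative
    - (\<i> * of_real (\<nu> / (p\<^sup>2 * (1 + p\<^sup>2)))) * exp (\<i> * of_real (wkb_phase \<nu> p))) (at p)"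
proof -
  have p2: "1 + p\<^sup>2 > 0" by (intro add_pos_nonneg) auto
  have inv: "((\<lambda>p. 1 / p) has_real_derivative - 1 / p\<^sup>2) (at p)"
    using assms by (auto intro!: derivative_eq_intros simp: power2_eq_square)
  have "(wkb_phase \<nu> has_real_derivative
      \<nu> * (- 1 / p\<^sup>2 - inverse (1 + (1 / p)\<^sup>2) * (- 1 / p\<^sup>2)) - 0) (at p)"
    unfolding wkb_phase_def
    by (intro DERIV_diff DERIV_cmult inv DERIV_chain2[OF DERIV_arctan inv] DERIV_const)
  also have "inverse (1 + (1 / p)\<^sup>2) = p\<^sup>2 / (1 + p\<^sup>2)"
    using assms p2 by (simp add: power_divide field_simps)
  also have "\<nu> * (- 1 / p\<^sup>2 - p\<^sup>2 / (1 + p\<^sup>2) * (- 1 / p\<^sup>2)) - 0 = - (\<nu> / (p\<^sup>2 * (1 + p\<^sup>2)))"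
  proof -
    have "- 1 / p\<^sup>2 - p\<^sup>2 / (1 + p\<^sup>2) * (- 1 / p\<^sup>2) = - (1 / (p\<^sup>2 * (1 + p\<^sup>2)))"
      using assms p2 by (simp add: divide_simps)
    then show ?thesis by simp
  qed
  finally have "((\<lambda>p. complex_of_real (wkb_phase \<nu> p)) has_vector_derivative of_real (- (\<nu> / (p\<^sup>2 * (1 + p\<^sup>2))))) (at p)"
    by (rule has_vector_derivative_of_real)
  then have "((\<lambda>p. \<i> * complex_of_real (wkb_phase \<nu> p)) has_vector_derivative \<i> * of_real (- (\<nu> / (p\<^sup>2 * (1 + p\<^sup>2))))) (at p)"
    by (rule has_vector_derivative_mult_right)
  from field_vector_diff_chain_at[OF this DERIV_exp] show ?thesis
    by (simp add: o_def)
qed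

text \<open>The exact system up to a source term in the second equation, which is the residual of
  the polynomials. As the coefficients are real, complex conjugates satisfy the system with the
  conjugate source.\<close>

lemma wkb_approx_system:
  assumes \<nu>: "\<nu> > 0" and p: "p > 0"
  shows "(wkb_Y n \<nu> has_vector_derivative - of_real (\<nu> / (p\<^sup>2 * (1 + p\<^sup>2))) * wkb_X n \<nu> p) (at p)"
    and "(wkb_X n \<nu> has_vector_derivative
      of_real (\<nu> / (p\<^sup>2 * (1 + p\<^sup>2)) + (1 + 5 * p\<^sup>2) / (4 * \<nu>)) * wkb_Y n \<nu> p
      - exp (\<i> * of_real (wkb_phase \<nu> p)) * (2 * \<i> / of_real \<nu> ^ Suc n * poly (pderiv (debye (Suc n))) (of_real p))) (at p)"
proof -
  define P where "P = complex_of_real p"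
  define N where "N = complex_of_real \<nu>"
  define E where "E = (\<lambda>p. exp (\<i> * of_real (wkb_phase \<nu> p)))"
  define Z where "Z = wkb_poly n \<nu>"
  define k where "k = complex_of_real (\<nu> / (p\<^sup>2 * (1 + p\<^sup>2)))"
  have nz: "P \<noteq> 0" "N \<noteq> 0" "1 + P\<^sup>2 \<noteq> 0"
  proof -
    have "1 + p\<^sup>2 > 0" by (intro add_pos_nonneg) auto
    moreover have "1 + P\<^sup>2 = of_real (1 + p\<^sup>2)" by (simp add: P_def)
    ultimately show "1 + P\<^sup>2 \<noteq> 0" by (simp only: of_real_eq_0_iff)
  qed (use p \<nu> in \<open>auto simp: P_def N_def\<close>)
  have k: "k = N / (P\<^sup>2 * (1 + P\<^sup>2))" by (simp add: k_def N_def P_def)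
  have E': "(E has_vector_derivative - (\<i> * k) * E p) (at p)"
    unfolding E_def k_def by (rule wkb_phase_deriv[OF p])
  have Q: "poly ([:0, 0, 1, 0, 1:] * f) P = P\<^sup>2 * (1 + P\<^sup>2) * poly f P" for f
    by (simp add: algebra_simps power2_eq_square)
  have Y: "wkb_Y n \<nu> = (\<lambda>p. E p * poly Z (of_real p))"
    by (auto simp: wkb_Y_def E_def Z_def)
  have X: "wkb_X n \<nu> = (\<lambda>p. E p * (\<i> * poly Z (of_real p) - poly ([:0, 0, 1, 0, 1:] * pderiv Z) (of_real p) / N))"
    by (intro ext) (simp only: wkb_X_def E_def Z_def N_def)
  have "(wkb_Y n \<nu> has_vector_derivative E p * poly (pderiv Z) P + - (\<i> * k) * E p * poly Z P) (at p)"
    unfolding Y P_def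
    by (intro has_vector_derivative_mult has_vector_derivative_poly_of_real E' )
  moreover have "E p * poly (pderiv Z) P + - (\<i> * k) * E p * poly Z P = - k * wkb_X n \<nu> p"
  proof -
    have *: "y / N * k = x \<Longrightarrow> E p * x + - (\<i> * k) * E p * z = - k * (E p * (\<i> * z - y / N))" for x y z
      by (auto simp: algebra_simps)
    show ?thesis
      unfolding X P_def[symmetric] by (rule *) (use nz in \<open>simp only: Q k, simp\<close>)
  qed
  ultimately show "(wkb_Y n \<nu> has_vector_derivative - of_real (\<nu> / (p\<^sup>2 * (1 + p\<^sup>2))) * wkb_X n \<nu> p) (at p)"
    by (simp add: k_def)
  define R where "R = 2 * \<i> / N ^ Suc n * poly (pderiv (debye (Suc n))) P"
  define qq where "qq = poly (pderiv ([:0, 0, 1, 0, 1:] * pderiv Z)) P"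
  have "poly (smult (2 * \<i>) (pderiv Z) - smult (1 / N)
      (pderiv ([:0, 0, 1, 0, 1:] * pderiv Z) + [:1/4, 0, 5/4:] * Z)) P = - R"
    unfolding Z_def N_def R_def using wkb_poly_residual[of \<nu> n] \<nu> by simp
  then have res: "\<i> * poly (pderiv Z) P - qq / N
      = (1 + 5 * P\<^sup>2) / (4 * N) * poly Z P - \<i> * poly (pderiv Z) P - R"
    unfolding poly_diff poly_add poly_smult qq_def[symmetric]
    by (simp add: algebra_simps power2_eq_square add_divide_distrib)
  have "(wkb_X n \<nu> has_vector_derivative
      E p * (\<i> * poly (pderiv Z) P - qq / N)
      + - (\<i> * k) * E p * (\<i> * poly Z P - poly ([:0, 0, 1, 0, 1:] * pderiv Z) P / N)) (at p)"
    unfolding X P_def qq_def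
    by (intro has_vector_derivative_mult has_vector_derivative_diff has_vector_derivative_mult_right
        has_vector_derivative_divide has_vector_derivative_poly_of_real E')
  moreover have "E p * (\<i> * poly (pderiv Z) P - qq / N)
      + - (\<i> * k) * E p * (\<i> * poly Z P - poly ([:0, 0, 1, 0, 1:] * pderiv Z) P / N)
     = (k + (1 + 5 * P\<^sup>2) / (4 * N)) * (E p * poly Z P) - E p * R"
  proof -
    \<comment> \<open>Differentiating the phase returns \<kappa> Y plus i Z' (times the
      exponential), because p^2 (1 + p^2) \<kappa> / \<nu> = 1; the second term is cancelled by the
      one in \<open>res\<close>.\<close>
    have *: "y / N * k = x \<Longrightarrow> u = w * z - \<i> * x - R \<Longrightarrow>
      E p * u + - (\<i> * k) * E p * (\<i> * z - y / N) = (k + w) * (E p * z) - E p * R" for x y z u w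
    proof -
      assume 1: "y / N * k = x" and 2: "u = w * z - \<i> * x - R"
      have "E p * u + - (\<i> * k) * E p * (\<i> * z - y / N) = E p * u + k * (E p * z) + \<i> * E p * (y / N * k)"
        by (simp add: algebra_simps)
      then show ?thesis unfolding 1 2 by (simp add: algebra_simps)
    qed
    show ?thesis
      by (rule *[OF _ res]) (use nz in \<open>simp only: Q k, simp\<close>)
  qed
  ultimately show "(wkb_X n \<nu> has_vector_derivative
      of_real (\<nu> / (p\<^sup>2 * (1 + p\<^sup>2)) + (1 + 5 * p\<^sup>2) / (4 * \<nu>)) * wkb_Y n \<nu> p
      - exp (\<i> * of_real (wkb_phase \<nu> p)) * (2 * \<i> / of_real \<nu> ^ Suc n * poly (pderiv (debye (Suc n))) (of_real p))) (at p)"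
    by (simp add: k_def R_def E_def wkb_Y_def Z_def P_def N_def)
qed

text \<open>The functions in question oscillate without a limit as p tends to 0, so a factor g can
  be replaced by its limit only relative to a bounded comparison function h.\<close>

lemma tendsto_mult_diff_bounded:
  fixes f g h :: "'a \<Rightarrow> complex"
  assumes f: "((\<lambda>x. f x - h x) \<longlongrightarrow> 0) F" and h: "\<And>x. norm (h x) \<le> B" and g: "(g \<longlongrightarrow> l) F"
  shows "((\<lambda>x. g x * f x - l * h x) \<longlongrightarrow> 0) F"
proof -
  have "((\<lambda>x. norm (g x - l) * B) \<longlongrightarrow> norm (l - l) * B) F"
    by (intro tendsto_intros g)
  then have "((\<lambda>x. (g x - l) * h x) \<longlongrightarrow> 0) F"
    by (intro Lim_null_comparison[OF eventuallyI[of "\<lambda>x. norm ((g x - l) * h x) \<le> norm (g x - l) * B"]])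
       (simp_all add: norm_mult mult_left_mono h)
  from tendsto_add[OF tendsto_mult[OF g f] this] show ?thesis
    by (simp add: algebra_simps)
qed

lemma wkb_r_at_top: "\<nu> > 0 \<Longrightarrow> filterlim (wkb_r \<nu>) at_top (at_right 0)"
proof -
  assume "\<nu> > 0"
  moreover have "filterlim (\<lambda>p::real. sqrt (1 + 1 / p\<^sup>2)) at_top (at_right 0)"
    by real_asymp
  ultimately show ?thesis
    unfolding wkb_r_def by (intro filterlim_tendsto_pos_mult_at_top[OF tendsto_const])
qed

text \<open>sqrt (1 + 1 / p^2) - 1 / p tends to 0 and arctan (1 / p) to pi / 2, which accounts
  exactly for the constant pi \<nu> / 2. Hence the WKB phase carries the right additive
  constant.\<close>

lemma hankel_phase_wkb_phase:
  shows "((\<lambda>p. hankel_phase \<nu> (wkb_r \<nu> p) - wkb_phase \<nu> p) \<longlongrightarrow> 0) (at_right 0)"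
proof -
  have 1: "((\<lambda>p::real. sqrt (1 + 1 / p\<^sup>2) - 1 / p) \<longlongrightarrow> 0) (at_right 0)"
    by real_asymp
  have 2: "((\<lambda>p::real. arctan (1 / p)) \<longlongrightarrow> pi / 2) (at_right 0)"
    by real_asymp
  have "((\<lambda>p. \<nu> * (sqrt (1 + 1 / p\<^sup>2) - 1 / p) + \<nu> * (arctan (1 / p) - pi / 2))
      \<longlongrightarrow> \<nu> * 0 + \<nu> * (pi / 2 - pi / 2)) (at_right 0)"
    by (intro tendsto_intros 1 2)
  then show ?thesis
    unfolding hankel_phase_def wkb_r_def wkb_phase_def by (simp add: algebra_simps)
qed

text \<open>At the same r the phase of order \<nu> + 1 lags by pi / 2, a factor -i, and that order
  enters V with a minus sign; together this gives i \<Phi>.\<close>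

lemma wkb_tendsto:
  assumes \<nu>: "\<nu> > 1/2"
  defines "c \<equiv> complex_of_real (1 / sqrt (2 * pi))"
    and "\<Phi> \<equiv> (\<lambda>p. exp (\<i> * of_real (wkb_phase \<nu> p)))"
  shows "((\<lambda>p. wkb_W \<nu> p - c * (\<Phi> p + cnj (\<Phi> p))) \<longlongrightarrow> 0) (at_right 0)"
    and "((\<lambda>p. wkb_V \<nu> p - c * (\<i> * \<Phi> p + cnj (\<i> * \<Phi> p))) \<longlongrightarrow> 0) (at_right 0)"
proof -
  have \<nu>0: "\<nu> > 0" using \<nu> by simp
  define H where "H = (\<lambda>p. exp (\<i> * of_real (hankel_phase \<nu> (wkb_r \<nu> p))))"
  have nPhi: "norm (\<Phi> p) = 1" for p by (simp add: \<Phi>_def)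
  have cnjH: "cnj (H p) = exp (- \<i> * of_real (hankel_phase \<nu> (wkb_r \<nu> p)))" for p
    by (simp add: H_def exp_cnj)
  have HPhi: "((\<lambda>p. H p - \<Phi> p) \<longlongrightarrow> 0) (at_right 0)"
  proof (rule Lim_null_comparison[OF eventuallyI])
    fix p
    have "H p - \<Phi> p = \<Phi> p * (exp (\<i> * of_real (hankel_phase \<nu> (wkb_r \<nu> p) - wkb_phase \<nu> p)) - 1)"
      by (simp add: H_def \<Phi>_def right_diff_distrib flip: exp_add)
    then show "norm (H p - \<Phi> p) \<le> norm (exp (\<i> * of_real (hankel_phase \<nu> (wkb_r \<nu> p) - wkb_phase \<nu> p)) - 1)"
      by (simp only: norm_mult nPhi mult_1 order_refl)
  next
    have "((\<lambda>p. norm (exp (\<i> * of_real (hankel_phase \<nu> (wkb_r \<nu> p) - wkb_phase \<nu> p)) - 1)) \<longlongrightarrow>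
        norm (exp (\<i> * of_real 0) - 1 :: complex)) (at_right 0)"
      by (intro tendsto_intros hankel_phase_wkb_phase)
    then show "((\<lambda>p. norm (exp (\<i> * of_real (hankel_phase \<nu> (wkb_r \<nu> p) - wkb_phase \<nu> p)) - 1)) \<longlongrightarrow> 0) (at_right 0)"
      by simp
  qed
  define B where "B = (\<lambda>\<mu> p. of_real (sqrt (wkb_r \<nu> p)) * bessel_J \<mu> (wkb_r \<nu> p))"
  \<comment> \<open>\<open>w\<close> is the phase factor of the order \<mu> relative to \<nu>: 1 for
    \<nu> and -i for \<nu> + 1.\<close>
  have B_lim: "((\<lambda>p. B \<mu> p - c * (w * \<Phi> p + cnj (w * \<Phi> p))) \<longlongrightarrow> 0) (at_right 0)"
    if "\<mu> > 1/2" and w: "\<And>p. exp (\<i> * of_real (hankel_phase \<mu> (wkb_r \<nu> p))) = w * H p" for \<mu> w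
  proof -
    have 1: "((\<lambda>p. B \<mu> p - c * (w * H p + cnj (w * H p))) \<longlongrightarrow> 0) (at_right 0)"
    proof -
      have "cnj (w * H p) = exp (- \<i> * of_real (hankel_phase \<mu> (wkb_r \<nu> p)))" for p
        unfolding w[symmetric] by (simp add: exp_cnj)
      then show ?thesis
        using filterlim_compose[OF bessel_J_asymp[OF that(1)] wkb_r_at_top[OF \<nu>0]]
        by (simp only: B_def c_def w)
    qed
    have "((\<lambda>p. c * (w * (H p - \<Phi> p) + cnj (w * (H p - \<Phi> p)))) \<longlongrightarrow> c * (w * 0 + cnj (w * 0))) (at_right 0)"
      by (intro tendsto_intros HPhi)
    from tendsto_add[OF 1 this] show ?thesis
      by (simp add: algebra_simps)
  qed
  have B0: "((\<lambda>p. B \<nu> p - c * (1 * \<Phi> p + cnj (1 * \<Phi> p))) \<longlongrightarrow> 0) (at_right 0)"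
    by (rule B_lim[OF \<nu>]) (simp add: H_def)
  have B1: "((\<lambda>p. B (\<nu> + 1) p - c * (- \<i> * \<Phi> p + cnj (- \<i> * \<Phi> p))) \<longlongrightarrow> 0) (at_right 0)"
  proof (rule B_lim)
    fix p
    have e0: "exp (\<i> * of_real (pi / 2)) = \<i>"
      by (simp only: cis_conv_exp[symmetric] cis_pi_half)
    have "\<i> * of_real (hankel_phase (\<nu> + 1) (wkb_r \<nu> p))
        = - (\<i> * of_real (pi / 2)) + \<i> * of_real (hankel_phase \<nu> (wkb_r \<nu> p))"
      by (simp add: hankel_phase_def algebra_simps)
    then show "exp (\<i> * of_real (hankel_phase (\<nu> + 1) (wkb_r \<nu> p))) = - \<i> * H p"
      unfolding H_def using e0 by (simp only: exp_add exp_minus) simp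
  qed (use \<nu> in simp)
  have bnd: "norm (c * (w * \<Phi> p + cnj (w * \<Phi> p))) \<le> norm c * 2" if "norm w = 1" for w p
  proof -
    have "norm (w * \<Phi> p + cnj (w * \<Phi> p)) \<le> norm (w * \<Phi> p) + norm (cnj (w * \<Phi> p))"
      by (rule norm_triangle_ineq)
    also have "\<dots> = 2" unfolding complex_mod_cnj by (simp add: norm_mult that nPhi)
    finally show ?thesis unfolding norm_mult[of c] by (rule mult_left_mono) simp
  qed
  \<comment> \<open>Coefficients of W and V relative to sqrt r times the Bessel functions. As
    \<open>g2\<close> tends to 0, only the order \<nu> + 1 contributes to V in the limit.\<close>
  define g1 where "g1 = (\<lambda>p. sqrt (\<nu> / p) / sqrt (wkb_r \<nu> p))"
  define g2 where "g2 = (\<lambda>p. sqrt (\<nu> / p) * p / \<nu> * ((1 + p\<^sup>2) / 2 + \<nu>) / sqrt (wkb_r \<nu> p))"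
  define g3 where "g3 = (\<lambda>p. sqrt (\<nu> / p) * p / \<nu> * sqrt (wkb_r \<nu> p))"
  have g1: "(g1 \<longlongrightarrow> 1) (at_right 0)" and g2: "(g2 \<longlongrightarrow> 0) (at_right 0)" and g3: "(g3 \<longlongrightarrow> 1) (at_right 0)"
    using \<nu>0 unfolding g1_def g2_def g3_def wkb_r_def
    by (real_asymp, real_asymp, real_asymp) (simp add: powr_half_sqrt field_simps)
  have sR: "complex_of_real (sqrt (wkb_r \<nu> p)) \<noteq> 0" "of_real (sqrt (wkb_r \<nu> p)) * of_real (sqrt (wkb_r \<nu> p)) = complex_of_real (wkb_r \<nu> p)" for p
    using wkb_r_pos[OF \<nu>0, of p] by (simp_all flip: of_real_mult)
  have W: "wkb_W \<nu> p = of_real (g1 p) * B \<nu> p" for p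
    using sR by (simp add: wkb_W_def g1_def B_def)
  have V: "wkb_V \<nu> p = of_real (g2 p) * B \<nu> p - of_real (g3 p) * B (\<nu> + 1) p" for p
  proof -
    have "of_real (g3 p) * B (\<nu> + 1) p = of_real (sqrt (\<nu> / p) * p / \<nu>) * (of_real (sqrt (wkb_r \<nu> p)) * of_real (sqrt (wkb_r \<nu> p))) * bessel_J (\<nu> + 1) (wkb_r \<nu> p)"
      by (simp add: g3_def B_def)
    also have "\<dots> = of_real (sqrt (\<nu> / p) * p / \<nu>) * (of_real (wkb_r \<nu> p) * bessel_J (\<nu> + 1) (wkb_r \<nu> p))"
      unfolding sR by simp
    finally have 3: "of_real (g3 p) * B (\<nu> + 1) p = of_real (sqrt (\<nu> / p) * p / \<nu>) * (of_real (wkb_r \<nu> p) * bessel_J (\<nu> + 1) (wkb_r \<nu> p))" .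
    have 2: "of_real (g2 p) * B \<nu> p = of_real (sqrt (\<nu> / p) * p / \<nu>) * (of_real ((1 + p\<^sup>2) / 2 + \<nu>) * bessel_J \<nu> (wkb_r \<nu> p))"
      using sR(1)[of p] by (simp add: g2_def B_def)
    show ?thesis unfolding 2 3 wkb_V_def wkb_K_def by (simp add: algebra_simps)
  qed
  have "((\<lambda>p. of_real (g1 p) * B \<nu> p - of_real 1 * (c * (1 * \<Phi> p + cnj (1 * \<Phi> p)))) \<longlongrightarrow> 0) (at_right 0)"
    by (rule tendsto_mult_diff_bounded[OF B0 bnd]) (use tendsto_of_real[OF g1, where ?'a = complex] in simp_all)
  then show "((\<lambda>p. wkb_W \<nu> p - c * (\<Phi> p + cnj (\<Phi> p))) \<longlongrightarrow> 0) (at_right 0)"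
    by (simp add: W)
  have 1: "((\<lambda>p. of_real (g2 p) * B \<nu> p - of_real 0 * (c * (1 * \<Phi> p + cnj (1 * \<Phi> p)))) \<longlongrightarrow> 0) (at_right 0)"
    by (rule tendsto_mult_diff_bounded[OF B0 bnd]) (use tendsto_of_real[OF g2, where ?'a = complex] in simp_all)
  have 2: "((\<lambda>p. of_real (g3 p) * B (\<nu> + 1) p - of_real 1 * (c * (- \<i> * \<Phi> p + cnj (- \<i> * \<Phi> p)))) \<longlongrightarrow> 0) (at_right 0)"
    by (rule tendsto_mult_diff_bounded[OF B1 bnd]) (use tendsto_of_real[OF g3, where ?'a = complex] in simp_all)
  show "((\<lambda>p. wkb_V \<nu> p - c * (\<i> * \<Phi> p + cnj (\<i> * \<Phi> p))) \<longlongrightarrow> 0) (at_right 0)"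
    using tendsto_diff[OF 1 2] by (simp add: V algebra_simps)
qed

text \<open>At p = 0 only \<open>debye 0 = 1\<close> survives, and the derivative term of X is
  killed by its factor p^2 (1 + p^2).\<close>

lemma wkb_approx_tendsto:
  defines "\<Phi> \<equiv> (\<lambda>\<nu> p. exp (\<i> * of_real (wkb_phase \<nu> p)))"
  shows "((\<lambda>p. wkb_Y n \<nu> p - \<Phi> \<nu> p) \<longlongrightarrow> 0) (at_right 0)"
    and "((\<lambda>p. wkb_X n \<nu> p - \<i> * \<Phi> \<nu> p) \<longlongrightarrow> 0) (at_right 0)"
proof -
  have nPhi: "norm (\<Phi> \<nu> p) \<le> 1" for p by (simp add: \<Phi>_def)
  have pl: "((\<lambda>p. poly f (complex_of_real p)) \<longlongrightarrow> poly f 0) (at_right 0)" for f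
  proof -
    have "isCont (\<lambda>p. poly f (complex_of_real p)) 0"
      by (rule has_vector_derivative_continuous[OF has_vector_derivative_poly_of_real])
    then have "((\<lambda>p. poly f (complex_of_real p)) \<longlongrightarrow> poly f 0) (at 0)"
      by (simp add: isCont_def)
    then show ?thesis by (rule tendsto_within_subset) simp
  qed
  have Z0: "poly (wkb_poly n \<nu>) 0 = 1"
    by (simp add: wkb_poly_def poly_sum poly_debye_0 sum.atMost_shift)
  have z: "((\<lambda>p. \<Phi> \<nu> p - \<Phi> \<nu> p) \<longlongrightarrow> 0) (at_right (0::real))" by simp
  have "((\<lambda>p. poly (wkb_poly n \<nu>) (complex_of_real p)) \<longlongrightarrow> 1) (at_right 0)"
    using pl[of "wkb_poly n \<nu>"] by (simp add: Z0)
  from tendsto_mult_diff_bounded[OF z nPhi this]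
  show "((\<lambda>p. wkb_Y n \<nu> p - \<Phi> \<nu> p) \<longlongrightarrow> 0) (at_right 0)"
    by (simp add: wkb_Y_def \<Phi>_def mult.commute)
  have "((\<lambda>p. \<i> * poly (wkb_poly n \<nu>) (of_real p) - poly ([:0, 0, 1, 0, 1:] * pderiv (wkb_poly n \<nu>)) (of_real p) / of_real \<nu>)
      \<longlongrightarrow> \<i> * poly (wkb_poly n \<nu>) 0 - poly ([:0, 0, 1, 0, 1:] * pderiv (wkb_poly n \<nu>)) 0 * inverse (of_real \<nu>)) (at_right 0)"
    unfolding divide_inverse by (intro tendsto_diff tendsto_mult tendsto_const pl)
  then have "((\<lambda>p. \<i> * poly (wkb_poly n \<nu>) (of_real p) - poly ([:0, 0, 1, 0, 1:] * pderiv (wkb_poly n \<nu>)) (of_real p) / of_real \<nu>)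
      \<longlongrightarrow> \<i>) (at_right 0)"
    by (simp add: Z0)
  from tendsto_mult_diff_bounded[OF z nPhi this]
  show "((\<lambda>p. wkb_X n \<nu> p - \<i> * \<Phi> \<nu> p) \<longlongrightarrow> 0) (at_right 0)"
    by (simp add: wkb_X_def \<Phi>_def mult.commute)
qed

section \<open>Uniform error of the WKB approximation\<close>

lemma poly_pderiv_debye:
  "poly (pderiv (debye k)) x = (\<Sum>j=k..3*k. coeff (debye k) j * (of_nat j * x ^ (j - 1)))"
proof (rule DERIV_unique)
  show "(poly (debye k) has_field_derivative poly (pderiv (debye k)) x) (at x)"
    by (rule poly_DERIV)
  have "poly (debye k) = (\<lambda>x. \<Sum>j=k..3*k. coeff (debye k) j * x ^ j)"
    by (intro ext poly_debye)
  then show "(poly (debye k) has_field_derivative (\<Sum>j=k..3*k. coeff (debye k) j * (of_nat j * x ^ (j - 1)))) (at x)"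
    by (auto intro!: derivative_eq_intros sum.cong)
qed

lemma power_le_add_powers:
  fixes p :: real
  assumes "p > 0" "1 \<le> j" "j \<le> m"
  shows "p ^ j \<le> p + p ^ m"
proof (cases "p \<le> 1")
  case True
  then have "p ^ j \<le> p ^ 1" using assms by (intro power_decreasing) auto
  then show ?thesis using assms by (simp add: add_increasing2)
next
  case False
  then have "p ^ j \<le> p ^ m" using assms by (intro power_increasing) auto
  then show ?thesis using assms by simp
qed

text \<open>\<open>energy_estimate\<close> for the differences of exact and approximate solutions.
  The condition p^3 \<le> \<nu> keeps b bounded, so the Gronwall factor is a constant independent of
  \<nu> and p.\<close>

lemma wkb_error:
  obtains C where "C > 0" "\<And>\<nu> p. \<nu> \<ge> 1 \<Longrightarrow> p > 0 \<Longrightarrow> p ^ 3 \<le> \<nu> \<Longrightarrow>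
    norm (wkb_W \<nu> p - of_real (1 / sqrt (2 * pi)) * (wkb_Y n \<nu> p + cnj (wkb_Y n \<nu> p)))
    \<le> C / \<nu> ^ Suc n * (p + p ^ (3 * Suc n))"
proof -
  define d where "d = (\<lambda>j. norm (coeff (debye (Suc n)) j))"
  \<comment> \<open>The extra 1 ensures M > 0 whatever the coefficients are.\<close>
  define B where "B = (\<Sum>j=Suc n..3 * Suc n. d j) + 1"
  have d: "d j \<ge> 0" for j by (simp add: d_def)
  have B: "B > 0" unfolding B_def by (intro add_nonneg_pos sum_nonneg d) auto
  define c where "c = complex_of_real (1 / sqrt (2 * pi))"
  \<comment> \<open>With |c| \<le> 1/2 the residual and its conjugate together cost no more than one
    residual.\<close>
  have c: "norm c \<le> 1 / 2"
  proof -
    have "sqrt 4 \<le> sqrt (2 * pi)" using pi_ge_two by (intro real_sqrt_le_mono) simp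
    then show ?thesis unfolding c_def norm_of_real by (simp add: field_simps)
  qed
  \<comment> \<open>In the constant 6, a factor 2 comes from the residual and a factor 3 bounds the
    exponential of the energy estimate.\<close>
  have "norm (wkb_W \<nu> p - c * (wkb_Y n \<nu> p + cnj (wkb_Y n \<nu> p))) \<le> (6 * B) / \<nu> ^ Suc n * (p + p ^ (3 * Suc n))"
    if \<nu>: "\<nu> \<ge> 1" and p: "p > 0" and p3: "p ^ 3 \<le> \<nu>" for \<nu> p
  proof -
    define E where "E = (\<lambda>x. exp (\<i> * of_real (wkb_phase \<nu> x)))"
    define \<rho> where "\<rho> = (\<lambda>x. E x * (2 * \<i> / of_real \<nu> ^ Suc n * poly (pderiv (debye (Suc n))) (of_real x)))"
    define D where "D = (\<lambda>x. wkb_W \<nu> x - c * (wkb_Y n \<nu> x + cnj (wkb_Y n \<nu> x)))"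
    define F where "F = (\<lambda>x. wkb_V \<nu> x - c * (wkb_X n \<nu> x + cnj (wkb_X n \<nu> x)))"
    define \<kappa> where "\<kappa> = (\<lambda>x. \<nu> / (x\<^sup>2 * (1 + x\<^sup>2)))"
    \<comment> \<open>Primitive, vanishing at 0, of the coefficient that accompanies
      \<kappa>.\<close>
    define b where "b = (\<lambda>x. (x + 5 * x ^ 3 / 3) / (4 * \<nu>))"
    define b' where "b' = (\<lambda>x. (1 + 5 * x\<^sup>2) / (4 * \<nu>))"
    \<comment> \<open>Majorant of the integrated residual, with absolute values taken coefficient by
      coefficient.\<close>
    define m where "m = (\<lambda>x. 2 / \<nu> ^ Suc n * (\<Sum>j=Suc n..3 * Suc n. d j * x ^ j))"
    define m' where "m' = (\<lambda>x. 2 / \<nu> ^ Suc n * (\<Sum>j=Suc n..3 * Suc n. d j * (of_nat j * x ^ (j - 1))))"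
    define M where "M = 2 / \<nu> ^ Suc n * (B * (p + p ^ (3 * Suc n)))"
    have M: "M > 0" unfolding M_def using B p \<nu> by (intro mult_pos_pos divide_pos_pos add_pos_pos zero_less_power) auto
    have mM: "m p \<le> M"
    proof -
      have "(\<Sum>j=Suc n..3 * Suc n. d j * p ^ j) \<le> (\<Sum>j=Suc n..3 * Suc n. d j * (p + p ^ (3 * Suc n)))"
        using p by (intro sum_mono mult_left_mono power_le_add_powers d) auto
      also have "\<dots> = (B - 1) * (p + p ^ (3 * Suc n))"
        by (simp add: B_def sum_distrib_right)
      also have "\<dots> \<le> B * (p + p ^ (3 * Suc n))"
        using p by (intro mult_right_mono) auto
      finally show ?thesis
        unfolding m_def M_def using \<nu> by (intro mult_left_mono) auto
    qed
    have "norm (D p) \<le> M * exp ((b p + 1) / 2)"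
    proof (rule energy_estimate[where D = D and P = p and M = M and b = b and F = F and G = "\<lambda>x. c * (\<rho> x + cnj (\<rho> x))" and \<kappa> = \<kappa> and b' = b' and m' = m' and m = m])
      fix x :: real assume x: "0 < x" "x \<le> p"
      have \<nu>': "\<nu> > 1/2" "\<nu> > 0" using \<nu> by auto
      note cnj' = bounded_linear.has_vector_derivative[OF bounded_linear_cnj]
      have W: "(wkb_W \<nu> has_vector_derivative - of_real (\<kappa> x) * wkb_V \<nu> x) (at x)"
        and V: "(wkb_V \<nu> has_vector_derivative of_real (\<kappa> x + b' x) * wkb_W \<nu> x) (at x)"
        unfolding \<kappa>_def b'_def by (rule wkb_system[OF \<nu>'(1) x(1)])+
      have Y: "(wkb_Y n \<nu> has_vector_derivative - of_real (\<kappa> x) * wkb_X n \<nu> x) (at x)"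
        and X: "(wkb_X n \<nu> has_vector_derivative of_real (\<kappa> x + b' x) * wkb_Y n \<nu> x - \<rho> x) (at x)"
        unfolding \<kappa>_def b'_def \<rho>_def E_def by (rule wkb_approx_system[OF \<nu>'(2) x(1)])+
      have "(D has_vector_derivative - of_real (\<kappa> x) * wkb_V \<nu> x -
          c * (- of_real (\<kappa> x) * wkb_X n \<nu> x + cnj (- of_real (\<kappa> x) * wkb_X n \<nu> x))) (at x)"
        unfolding D_def
        by (intro has_vector_derivative_diff has_vector_derivative_mult_right has_vector_derivative_add W Y cnj')
      then show "(D has_vector_derivative - of_real (\<kappa> x) * F x) (at x)"
        by (simp add: F_def algebra_simps)
      have "(F has_vector_derivative of_real (\<kappa> x + b' x) * wkb_W \<nu> x -
          c * ((of_real (\<kappa> x + b' x) * wkb_Y n \<nu> x - \<rho> x) + cnj (of_real (\<kappa> x + b' x) * wkb_Y n \<nu> x - \<rho> x))) (at x)"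
        unfolding F_def
        by (intro has_vector_derivative_diff has_vector_derivative_mult_right has_vector_derivative_add V X cnj')
      moreover have "of_real (\<kappa> x + b' x) * wkb_W \<nu> x -
          c * ((of_real (\<kappa> x + b' x) * wkb_Y n \<nu> x - \<rho> x) + cnj (of_real (\<kappa> x + b' x) * wkb_Y n \<nu> x - \<rho> x))
          = of_real (\<kappa> x + b' x) * D x + c * (\<rho> x + cnj (\<rho> x))"
        unfolding D_def complex_cnj_diff complex_cnj_mult complex_cnj_complex_of_real
        by (simp only: algebra_simps)
      ultimately show "(F has_vector_derivative of_real (\<kappa> x + b' x) * D x + c * (\<rho> x + cnj (\<rho> x))) (at x)"
        by simp
      show "norm (c * (\<rho> x + cnj (\<rho> x))) \<le> m' x"
      proof -
        have "norm (\<rho> x + cnj (\<rho> x)) \<le> 2 * norm (\<rho> x)"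
          using norm_triangle_ineq[of "\<rho> x" "cnj (\<rho> x)"] by simp
        then have "norm c * norm (\<rho> x + cnj (\<rho> x)) \<le> 1 / 2 * (2 * norm (\<rho> x))"
          by (intro mult_mono c) auto
        then have "norm (c * (\<rho> x + cnj (\<rho> x))) \<le> norm (\<rho> x)"
          by (simp add: norm_mult)
        also have "norm (\<rho> x) = 2 / \<nu> ^ Suc n * norm (poly (pderiv (debye (Suc n))) (of_real x))"
          using \<nu> by (simp add: \<rho>_def E_def norm_mult norm_divide norm_power)
        also have "\<dots> \<le> m' x"
          unfolding m'_def poly_pderiv_debye
        proof (intro mult_left_mono sum_norm_le)
          show "norm (coeff (debye (Suc n)) j * (of_nat j * complex_of_real x ^ (j - 1))) \<le> d j * (real j * x ^ (j - 1))" for j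
            using x by (simp add: norm_mult norm_power d_def)
        qed (use \<nu> in auto)
        finally show ?thesis .
      qed
      show "(b has_real_derivative b' x) (at x)"
        unfolding b_def b'_def using \<nu> by (auto intro!: derivative_eq_intros simp: field_simps)
      show "(m has_real_derivative m' x) (at x)"
        unfolding m_def m'_def using DERIV_pow
        by (intro DERIV_cmult DERIV_sum) simp
      show "0 \<le> b' x" unfolding b'_def using \<nu> by simp
    next
      have lim0: "((\<lambda>x. f x) \<longlongrightarrow> 0) (at_right 0)" if "isCont f 0" "f 0 = 0" for f :: "real \<Rightarrow> real"
        using that by (auto simp: isCont_def intro: tendsto_within_subset)
      show "(b \<longlongrightarrow> 0) (at_right 0)"
        unfolding b_def using \<nu> by (intro lim0 continuous_intros) auto
      show "(m \<longlongrightarrow> 0) (at_right 0)"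
        unfolding m_def by (intro lim0 continuous_intros) auto
      have \<nu>': "\<nu> > 1/2" using \<nu> by simp
      have t: "((\<lambda>x. f x - c * (g x + cnj (g x))) \<longlongrightarrow> 0) (at_right 0)"
        if f: "((\<lambda>x. f x - c * (h x + cnj (h x))) \<longlongrightarrow> 0) (at_right 0)"
          and g: "((\<lambda>x. g x - h x) \<longlongrightarrow> 0) (at_right 0)" for f g h :: "real \<Rightarrow> complex"
      proof -
        have "((\<lambda>x. (f x - c * (h x + cnj (h x))) - c * ((g x - h x) + cnj (g x - h x))) \<longlongrightarrow> 0 - c * (0 + cnj 0)) (at_right 0)"
          by (intro tendsto_intros f g)
        then show ?thesis by (simp add: algebra_simps)
      qed
      show "(D \<longlongrightarrow> 0) (at_right 0)"
        unfolding D_def by (rule t[OF wkb_tendsto(1)[OF \<nu>', folded c_def] wkb_approx_tendsto(1)])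
      show "(F \<longlongrightarrow> 0) (at_right 0)"
        unfolding F_def by (rule t[OF wkb_tendsto(2)[OF \<nu>', folded c_def] wkb_approx_tendsto(2)])
    qed (use p M mM in auto)
    also have "M * exp ((b p + 1) / 2) \<le> M * 3"
    proof -
      have "p \<le> \<nu>"
      proof (cases "p \<le> 1")
        case False
        then have "p ^ 1 \<le> p ^ 3" by (intro power_increasing) auto
        then show ?thesis using p3 by simp
      qed (use \<nu> in auto)
      \<comment> \<open>p \<le> \<nu> and p^3 \<le> \<nu> bound b p by (8/3) / 4, so the exponent (b
        p + 1) / 2 is at most 1.\<close>
      then have "b p \<le> (\<nu> + 5 * \<nu> / 3) / (4 * \<nu>)"
        unfolding b_def using \<nu> p3 by (intro divide_right_mono add_mono) auto
      also have "\<dots> \<le> 1" using \<nu> by (simp add: field_simps)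
      finally have "exp ((b p + 1) / 2) \<le> exp 1" by simp
      also have "exp 1 \<le> (3 :: real)" by (rule exp_le)
      finally show ?thesis using M by (intro mult_left_mono) auto
    qed
    finally show ?thesis by (simp add: D_def M_def mult_ac)
  qed
  then show ?thesis
    using B by (intro that[of "6 * B"]) (auto simp: c_def)
qed

section \<open>Smoothness of the amplitudes\<close>

text \<open>\<open>nth_derivative\<close> iterates an operator with default values. On an open set,
  agreement with an explicit chain g of derivatives passes from each order to the next.\<close>

lemma nth_derivative_eq:
  assumes S: "open S" and f: "\<And>x. x \<in> S \<Longrightarrow> f x = g 0 x"
    and g: "\<And>l x. x \<in> S \<Longrightarrow> (g l has_vector_derivative g (Suc l) x) (at x)"
    and x: "x \<in> S"
  shows "nth_derivative l f x = g l x"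
  using x
proof (induction l arbitrary: x)
  case 0
  then show ?case by (simp add: nth_derivative_def f)
next
  case (Suc l)
  have "(nth_derivative l f has_vector_derivative g (Suc l) x) (at x)"
    by (rule has_vector_derivative_transform_within_open[OF g[OF Suc.prems] S Suc.prems])
       (simp add: Suc.IH)
  then show ?case
    by (simp add: nth_derivative_def vector_derivative_at)
qed

lemma smooth_on_open_sequence:
  assumes S: "open S" and f: "\<And>x. x \<in> S \<Longrightarrow> f x = g 0 x"
    and g: "\<And>l x. x \<in> S \<Longrightarrow> (g l has_vector_derivative g (Suc l) x) (at x)"
  shows "smooth_on_open S f"
  unfolding smooth_on_open_def
proof (intro conjI allI ballI S)
  fix l x assume x: "x \<in> S"
  have "(nth_derivative l f has_vector_derivative g (Suc l) x) (at x)"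
    by (rule has_vector_derivative_transform_within_open[OF g[OF x] S x])
       (simp add: nth_derivative_eq[OF S f g])
  then show "nth_derivative l f differentiable (at x)"
    by (rule differentiableI_vector)
qed

lemma has_vector_derivative_higher_deriv:
  assumes "F holomorphic_on U" "open U" "of_real x \<in> U"
  shows "((\<lambda>x. (deriv ^^ l) F (of_real x)) has_vector_derivative (deriv ^^ Suc l) F (of_real x)) (at x)"
proof -
  have "(deriv ^^ l) F holomorphic_on U"
    using assms by (intro holomorphic_higher_deriv)
  then have "((deriv ^^ l) F has_field_derivative (deriv ^^ Suc l) F (of_real x)) (at (of_real x))"
    using assms by (auto intro: holomorphic_derivI)
  then show ?thesis by (rule has_vector_derivative_real_field)
qed

text \<open>Continuity on a compact interval, endpoints included, is what yields bounds all the way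
  to x_0 = 0 and x_0 = pi/2.\<close>

lemma higher_deriv_bounded:
  assumes F: "F holomorphic_on U" "open U" and U: "of_real ` {a..b} \<subseteq> U"
  obtains C where "\<And>x. x \<in> {a..b} \<Longrightarrow> norm ((deriv ^^ l) F (of_real x)) \<le> C"
proof -
  have "(deriv ^^ l) F holomorphic_on U"
    using F by (intro holomorphic_higher_deriv)
  then have "continuous_on (of_real ` {a..b}) ((deriv ^^ l) F)"
    using U holomorphic_on_imp_continuous_on continuous_on_subset by blast
  then have "continuous_on {a..b} (\<lambda>x. (deriv ^^ l) F (of_real x))"
    by (rule continuous_on_compose2[OF _ continuous_on_of_real[OF continuous_on_id]]) auto
  then have "bounded ((\<lambda>x. (deriv ^^ l) F (of_real x)) ` {a..b})"
    using compact_continuous_image compact_imp_bounded by blast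
  then show ?thesis
    by (auto simp: bounded_iff intro: that)
qed

section \<open>Holomorphic extension of the amplitudes\<close>

definition csinc :: "complex \<Rightarrow> complex" where
  "csinc z = (if z = 0 then 1 else sin z / z)"

text \<open>As sin vanishes at 0, the singularity of sin z / z is removable, with value sin' 0 =
  1.\<close>

lemma holomorphic_csinc: "csinc holomorphic_on UNIV"
proof (rule pole_theorem_open_0[of sin _ 0])
  show "csinc 0 = deriv sin 0"
    by (simp add: csinc_def DERIV_imp_deriv[OF DERIV_sin])
qed (auto intro!: holomorphic_intros simp: csinc_def)

text \<open>With \<open>z = x\<^sub>0\<close>, so that \<open>\<nu> = r cos z\<close> and \<open>p = cot z\<close>, this is the coefficient that turns
  \<open>(r sin z)\<^bsup>-1/2\<^esup> \<nu>\<^bsup>-k\<^esup> Z\<^sub>k(p)\<close> into \<open>z (r z\<^sup>3)\<^bsup>-k-1/2\<^esup> a\<^sub>k(z) / k!\<close>. It is holomorphic near \<open>[0, \<pi>/2]\<close>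
  because \<open>Z\<^sub>k\<close> only has monomials of degrees \<open>k\<close> to \<open>3k\<close>.\<close>
definition debye_amp :: "nat \<Rightarrow> complex \<Rightarrow> complex" where
  "debye_amp k z = fact k / csqrt (csinc z) *
     (\<Sum>j=k..3*k. coeff (debye k) j * cos z ^ (j - k) / csinc z ^ j * z ^ (3 * k - j))"

text \<open>Here the principal square root of \<open>csinc\<close> is holomorphic and the powers of
  \<open>csinc\<close> can be inverted.\<close>

definition amp_domain :: "complex set" where
  "amp_domain = {z. csinc z \<notin> \<real>\<^sub>\<le>\<^sub>0}"

lemma open_amp_domain: "open amp_domain"
proof -
  have "continuous_on UNIV csinc"
    by (rule holomorphic_on_imp_continuous_on[OF holomorphic_csinc])
  then have "open (csinc -` (- \<real>\<^sub>\<le>\<^sub>0))"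
    by (intro open_vimage) auto
  moreover have "amp_domain = csinc -` (- \<real>\<^sub>\<le>\<^sub>0)"
    by (auto simp: amp_domain_def)
  ultimately show ?thesis by simp
qed

lemma holomorphic_debye_amp: "debye_amp k holomorphic_on amp_domain"
proof -
  have "csinc holomorphic_on amp_domain"
    by (rule holomorphic_on_subset[OF holomorphic_csinc]) simp
  moreover have "csinc z \<noteq> 0" "csqrt (csinc z) \<noteq> 0" if "z \<in> amp_domain" for z
    using that by (auto simp: amp_domain_def)
  ultimately show ?thesis
    unfolding debye_amp_def
    by (intro holomorphic_intros) (auto simp: amp_domain_def)
qed

lemma csinc_of_real:
  assumes "x \<noteq> 0"
  shows "csinc (of_real x) = of_real (sin x / x)"
  using assms by (simp add: csinc_def sin_of_real)

lemma amp_domain_of_real: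
  assumes "0 \<le> x" "x < pi"
  shows "of_real x \<in> amp_domain"
proof (cases "x = 0")
  case False
  then have "sin x / x > 0" using assms by (intro divide_pos_pos sin_gt_zero) auto
  then have "of_real (sin x / x) \<notin> (\<real>\<^sub>\<le>\<^sub>0 :: complex set)"
    by (simp only: nonpos_Reals_of_real_iff not_le)
  then show ?thesis
    by (simp only: amp_domain_def mem_Collect_eq csinc_of_real[OF False] not_False_eq_True)
qed (simp add: amp_domain_def csinc_def)

text \<open>The amplitude is holomorphic around the compact interval [0, pi/2], so each derivative
  is bounded there. The conjugate is differentiated along the real axis only, where its derivatives
  are the conjugates.\<close>

lemma debye_amp_smooth:
  shows "smooth_on_open {0<..<pi/2} (\<lambda>x. debye_amp k (of_real x))"
    and "smooth_on_open {0<..<pi/2} (\<lambda>x. cnj (debye_amp k (of_real x)))"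
    and "\<exists>C. \<forall>x\<in>{0<..<pi/2}. norm (nth_derivative l (\<lambda>x. debye_amp k (of_real x)) x)
           + norm (nth_derivative l (\<lambda>x. cnj (debye_amp k (of_real x))) x) \<le> C"
proof -
  define g where "g = (\<lambda>l x. (deriv ^^ l) (debye_amp k) (of_real x))"
  have dom: "of_real x \<in> amp_domain" if "x \<in> {0<..<pi/2}" for x
    using that by (intro amp_domain_of_real) auto
  have g: "(g l has_vector_derivative g (Suc l) x) (at x)" if "x \<in> {0<..<pi/2}" for l x
    unfolding g_def
    by (rule has_vector_derivative_higher_deriv[OF holomorphic_debye_amp open_amp_domain dom[OF that]])
  have g': "((\<lambda>x. cnj (g l x)) has_vector_derivative cnj (g (Suc l) x)) (at x)" if "x \<in> {0<..<pi/2}" for l x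
    by (rule bounded_linear.has_vector_derivative[OF bounded_linear_cnj g[OF that]])
  have f: "debye_amp k (of_real x) = g 0 x" "cnj (debye_amp k (of_real x)) = cnj (g 0 x)" for x
    by (simp_all add: g_def)
  have op: "open {0<..<pi/2}" by simp
  show "smooth_on_open {0<..<pi/2} (\<lambda>x. debye_amp k (of_real x))"
    by (rule smooth_on_open_sequence[where g = g, OF op f(1) g])
  show "smooth_on_open {0<..<pi/2} (\<lambda>x. cnj (debye_amp k (of_real x)))"
    by (rule smooth_on_open_sequence[where g = "\<lambda>l x. cnj (g l x)", OF op f(2) g'])
  have "of_real ` {0..pi/2} \<subseteq> amp_domain"
  proof (safe intro!: amp_domain_of_real)
    fix x :: real assume "x \<in> {0..pi/2}"
    then have "0 \<le> x" "x \<le> pi / 2" by auto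
    then show "0 \<le> x" "x < pi" using pi_gt_zero by linarith+
  qed
  then obtain C where C: "\<And>x. x \<in> {0..pi/2} \<Longrightarrow> norm (g l x) \<le> C"
    using higher_deriv_bounded[OF holomorphic_debye_amp open_amp_domain, where l = l]
    unfolding g_def by blast
  show "\<exists>C. \<forall>x\<in>{0<..<pi/2}. norm (nth_derivative l (\<lambda>x. debye_amp k (of_real x)) x)
           + norm (nth_derivative l (\<lambda>x. cnj (debye_amp k (of_real x))) x) \<le> C"
  proof (intro exI ballI)
    fix x assume x: "x \<in> {0<..<pi/2}"
    show "norm (nth_derivative l (\<lambda>x. debye_amp k (of_real x)) x)
           + norm (nth_derivative l (\<lambda>x. cnj (debye_amp k (of_real x))) x) \<le> C + C"
    proof -
      have "nth_derivative l (\<lambda>x. debye_amp k (of_real x)) x = g l x"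
        by (rule nth_derivative_eq[where g = g, OF op f(1) g x])
      moreover have "nth_derivative l (\<lambda>x. cnj (debye_amp k (of_real x))) x = cnj (g l x)"
        by (rule nth_derivative_eq[where g = "\<lambda>l x. cnj (g l x)", OF op f(2) g' x])
      ultimately show ?thesis using C[of x] x by simp
    qed
  qed
qed

section \<open>Uniform expansion\<close>

text \<open>The exponents of x add up to 1 - 3k - 3/2 + 1/2 + j + 3k - j = 0. Thus x_0 itself
  disappears and only r, S = sin x_0 and C = cos x_0 remain.\<close>

lemma debye_term:
  fixes r x S C :: real
  assumes pos: "r > 0" "x > 0" "S > 0" "C > 0" and j: "k \<le> j" "j \<le> 3 * k"
  shows "x * (r * x ^ 3) powr (- real k - 1/2) * (1 / sqrt (S / x)) * (C ^ (j - k) / (S / x) ^ j * x ^ (3 * k - j))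
    = 1 / sqrt (r * S) / (r * C) ^ k * (C / S) ^ j"
proof -
  have "(r * x ^ 3) powr (- real k - 1/2) = 1 / ((r * x ^ 3) powr real k * (r * x ^ 3) powr (1/2))"
  proof -
    have "- real k - 1/2 = - (real k + 1/2)" by simp
    then show ?thesis by (simp only: powr_minus_divide powr_add)
  qed
  also have "(r * x ^ 3) powr real k = r ^ k * x ^ (3 * k)"
    using pos by (simp add: powr_realpow power_mult_distrib power_mult)
  also have "(r * x ^ 3) powr (1/2) = x * (sqrt r * sqrt x)"
    using pos by (simp add: powr_half_sqrt real_sqrt_mult power3_eq_cube)
  finally have 1: "(r * x ^ 3) powr (- real k - 1/2) = 1 / (r ^ k * x ^ (3 * k) * (x * (sqrt r * sqrt x)))" .
  have 2: "x ^ (3 * k) = x ^ j * x ^ (3 * k - j)" "C ^ j = C ^ k * C ^ (j - k)"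
    using j by (simp_all flip: power_add)
  show ?thesis
    unfolding 1 power_divide power_mult_distrib 2 real_sqrt_mult real_sqrt_divide
    using pos by simp
qed

text \<open>x_0 is an angle of the right triangle with hypotenuse r, adjacent leg \<nu> and opposite
  leg sqrt Q, so p = cot x_0. This translates between p and the quantities in the theorem.\<close>

lemma bessel_geometry:
  assumes \<nu>: "\<nu> > 0" and r: "r > \<nu>"
  defines "Q \<equiv> r\<^sup>2 - \<nu>\<^sup>2"
  defines "p \<equiv> \<nu> / sqrt Q"
  shows "Q > 0" "p > 0" "wkb_r \<nu> p = r" "wkb_phase \<nu> p = bessel_theta \<nu> r" "sqrt (\<nu> / p) = Q powr (1/4)"
    and "bessel_angle \<nu> r > 0" "cos (bessel_angle \<nu> r) = \<nu> / r" "sin (bessel_angle \<nu> r) = sqrt Q / r"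
proof -
  have "\<nu>\<^sup>2 < r\<^sup>2" using assms by (intro power_strict_mono) auto
  then show Q: "Q > 0" by (simp add: Q_def)
  then show p: "p > 0" using \<nu> by (simp add: p_def)
  have np: "\<nu> / p = sqrt Q" using \<nu> Q by (simp add: p_def)
  have ip: "1 / p = sqrt Q / \<nu>" by (simp add: p_def)
  have "wkb_r \<nu> p = \<nu> * sqrt ((r / \<nu>)\<^sup>2)"
  proof -
    have "1 + 1 / p\<^sup>2 = 1 + (1 / p)\<^sup>2" by (simp add: power_divide)
    also have "\<dots> = (r / \<nu>)\<^sup>2"
      unfolding ip power_divide real_sqrt_pow2[OF less_imp_le[OF Q]] using \<nu> by (simp add: Q_def field_simps)
    finally show ?thesis by (simp add: wkb_r_def)
  qed
  then show "wkb_r \<nu> p = r" using \<nu> r by simp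
  show "sqrt (\<nu> / p) = Q powr (1/4)"
    unfolding np using Q by (simp add: powr_powr flip: powr_half_sqrt)
  have nr: "0 < \<nu> / r" "\<nu> / r < 1" using \<nu> r by auto
  show cosx: "cos (bessel_angle \<nu> r) = \<nu> / r"
    unfolding bessel_angle_def using nr by (intro cos_arccos) auto
  have "arccos 1 < arccos (\<nu> / r)"
    using nr by (intro arccos_less_arccos) auto
  then show x0: "bessel_angle \<nu> r > 0" by (simp add: bessel_angle_def)
  have "sin (bessel_angle \<nu> r) = sqrt (1 - (\<nu> / r)\<^sup>2)"
    unfolding bessel_angle_def using nr by (intro sin_arccos) auto
  also have "1 - (\<nu> / r)\<^sup>2 = Q / r\<^sup>2"
    using \<nu> r by (simp add: Q_def field_simps)
  finally show sinx: "sin (bessel_angle \<nu> r) = sqrt Q / r"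
    using \<nu> r by (simp add: real_sqrt_divide)
  have "bessel_angle \<nu> r < pi / 2"
    using arccos_less_arccos[of 0 "\<nu> / r"] nr by (simp add: bessel_angle_def)
  then have "arctan (tan (bessel_angle \<nu> r)) = bessel_angle \<nu> r"
    using x0 by (intro arctan_tan) auto
  moreover have "tan (bessel_angle \<nu> r) = sqrt Q / \<nu>"
    unfolding tan_def sinx cosx using \<nu> r by simp
  ultimately have "arctan (1 / p) = arccos (\<nu> / r)"
    by (simp add: ip bessel_angle_def)
  moreover have "\<nu> * (1 / p) = Q powr (1/2)"
    using np Q by (simp add: powr_half_sqrt)
  ultimately show "wkb_phase \<nu> p = bessel_theta \<nu> r"
    unfolding wkb_phase_def bessel_theta_def Q_def right_diff_distrib by simp
qed

text \<open>Identifies the sum in powers of r x_0^3 with the Debye sum in powers of 1/\<nu>,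
  monomial by monomial through \<open>debye_term\<close>.\<close>

lemma bessel_sum_debye_amp:
  assumes \<nu>: "\<nu> > 0" and r: "r > \<nu>"
  defines "Q \<equiv> r\<^sup>2 - \<nu>\<^sup>2"
  shows "bessel_sum (\<lambda>k x. debye_amp k (of_real x)) K \<nu> r
    = of_real (1 / Q powr (1/4)) * (\<Sum>k=1..K. 1 / of_real \<nu> ^ k * poly (debye k) (of_real (\<nu> / sqrt Q)))"
proof -
  define x where "x = bessel_angle \<nu> r"
  define S where "S = sqrt Q / r"
  define C where "C = \<nu> / r"
  note geo = bessel_geometry[OF \<nu> r, folded Q_def]
  have x: "x > 0" and S: "sin x = S" and C: "cos x = C"
    using geo by (simp_all add: x_def S_def C_def)
  have pos: "r > 0" "x > 0" "S > 0" "C > 0"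
    using \<nu> r geo x by (auto simp: S_def C_def)
  have rS: "r * S = sqrt Q" "r * C = \<nu>" "C / S = \<nu> / sqrt Q"
    using pos by (auto simp: S_def C_def)
  have sinc: "csinc (of_real x) = of_real (S / x)"
    using csinc_of_real[of x] x by (simp only: S)
  have "0 \<le> S / x" using pos by simp
  then have sq: "csqrt (of_real (S / x)) = of_real (sqrt (S / x))"
    by (rule csqrt_of_real)
  have qq: "sqrt (sqrt Q) = Q powr (1/4)"
    using geo(1) by (simp add: powr_powr flip: powr_half_sqrt)
  have "of_real x * (of_real ((r * x ^ 3) powr (- real k - 1/2)) * debye_amp k (of_real x) / fact k)
    = of_real (1 / Q powr (1/4)) * (1 / of_real \<nu> ^ k * poly (debye k) (of_real (\<nu> / sqrt Q)))" for k
  proof -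
    have "of_real x * (of_real ((r * x ^ 3) powr (- real k - 1/2)) * debye_amp k (of_real x) / fact k)
      = (\<Sum>j=k..3*k. coeff (debye k) j * of_real (x * (r * x ^ 3) powr (- real k - 1/2) * (1 / sqrt (S / x)) *
          (C ^ (j - k) / (S / x) ^ j * x ^ (3 * k - j))))"
      unfolding debye_amp_def sinc sq cos_of_real C sum_distrib_left sum_divide_distrib
      by (intro sum.cong refl) simp
    also have "\<dots> = (\<Sum>j=k..3*k. coeff (debye k) j * of_real (1 / sqrt (r * S) / (r * C) ^ k * (C / S) ^ j))"
      by (intro sum.cong refl arg_cong2[of _ _ _ _ "(*)"] arg_cong[of _ _ of_real] debye_term pos) auto
    also have "\<dots> = of_real (1 / Q powr (1/4)) * (1 / of_real \<nu> ^ k * poly (debye k) (of_real (\<nu> / sqrt Q)))"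
      unfolding poly_debye rS qq sum_distrib_left
      by (intro sum.cong refl) simp
    finally show ?thesis .
  qed
  then show ?thesis
    by (simp only: bessel_sum_def Let_def x_def[symmetric] sum_distrib_left)
qed

lemma bessel_sum_cnj:
  "bessel_sum (\<lambda>k x. cnj (a k x)) K \<nu> r = cnj (bessel_sum a K \<nu> r)"
  by (simp add: bessel_sum_def Let_def)

definition bessel_expansion :: "nat \<Rightarrow> real \<Rightarrow> real \<Rightarrow> complex" where
  "bessel_expansion K \<nu> r =
     of_real ((2 * pi) powr (-1/2)) * exp (\<i> * of_real (bessel_theta \<nu> r)) *
       bessel_sum (\<lambda>k x. debye_amp k (of_real x)) K \<nu> r
   + of_real ((2 * pi) powr (-1/2)) * exp (- \<i> * of_real (bessel_theta \<nu> r)) *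
       bessel_sum (\<lambda>k x. cnj (debye_amp k (of_real x))) K \<nu> r"

text \<open>The main term is order 0 of the truncated WKB series, and
  \<open>bessel_expansion\<close> collects the orders 1 to K.\<close>

lemma bessel_main_expansion:
  assumes \<nu>: "\<nu> > 0" and r: "r > \<nu>"
  defines "Q \<equiv> r\<^sup>2 - \<nu>\<^sup>2"
  defines "p \<equiv> \<nu> / sqrt Q"
  shows "bessel_main \<nu> r + bessel_expansion K \<nu> r
    = of_real (1 / Q powr (1/4)) * (of_real (1 / sqrt (2 * pi)) * (wkb_Y K \<nu> p + cnj (wkb_Y K \<nu> p)))"
proof -
  note geo = bessel_geometry[OF \<nu> r, folded Q_def, folded p_def]
  define E where "E = exp (\<i> * of_real (bessel_theta \<nu> r))"
  define s where "s = (\<Sum>k=1..K. 1 / of_real \<nu> ^ k * poly (debye k) (of_real p))"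
  define A where "A = complex_of_real (1 / Q powr (1/4))"
  define c where "c = complex_of_real (1 / sqrt (2 * pi))"
  have c: "of_real ((2 * pi) powr (-1/2)) = c"
  proof -
    have "(2 * pi) powr (-1/2) = 1 / sqrt (2 * pi)"
      using powr_minus_divide[of "2 * pi" "1/2"] by (simp add: powr_half_sqrt)
    then show ?thesis by (simp only: c_def)
  qed
  have E: "exp (- \<i> * of_real (bessel_theta \<nu> r)) = cnj E"
    by (simp add: E_def exp_cnj)
  have sum: "bessel_sum (\<lambda>k x. debye_amp k (of_real x)) K \<nu> r = A * s"
    unfolding bessel_sum_debye_amp[OF \<nu> r] s_def p_def Q_def A_def ..
  have Acnj: "cnj A = A" by (simp add: A_def)
  have Y: "wkb_Y K \<nu> p = E * (1 + s)"
  proof -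
    have "poly (wkb_poly K \<nu>) (of_real p) = (\<Sum>k\<le>K. 1 / of_real \<nu> ^ k * poly (debye k) (of_real p))"
      by (simp add: wkb_poly_def poly_sum)
    also have "\<dots> = 1 + s"
      unfolding s_def by (simp add: atMost_atLeast0 sum.atLeast_Suc_atMost)
    finally show ?thesis by (simp add: wkb_Y_def geo(4) E_def)
  qed
  have main: "bessel_main \<nu> r = A * (c * (E + cnj E))"
    unfolding bessel_main_def E E_def[symmetric] Q_def[symmetric] A_def c_def by simp
  show ?thesis
    unfolding main bessel_expansion_def bessel_sum_cnj sum c E E_def[symmetric] Y
      A_def[symmetric] c_def[symmetric] complex_cnj_mult Acnj complex_cnj_add complex_cnj_one
    by (simp add: algebra_simps)
qed

text \<open>\<open>wkb_error\<close> at p = \<nu> / sqrt (r^2 - \<nu>^2), divided by (r^2 -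
  \<nu>^2)^{1/4}.\<close>

lemma debye_expansion:
  obtains C where "C > 0" "\<And>\<nu> r. \<nu> > 10 \<Longrightarrow> r > \<nu> + \<nu> powr (1/3) \<Longrightarrow>
    norm (bessel_J \<nu> r - (bessel_main \<nu> r + bessel_expansion K \<nu> r))
    \<le> C * (1 / (r\<^sup>2 - \<nu>\<^sup>2) powr (1/4) / \<nu> ^ Suc K *
        (\<nu> / sqrt (r\<^sup>2 - \<nu>\<^sup>2) + (\<nu> / sqrt (r\<^sup>2 - \<nu>\<^sup>2)) ^ (3 * Suc K)))"
proof -
  obtain C where C: "C > 0" "\<And>\<nu> p. \<nu> \<ge> 1 \<Longrightarrow> p > 0 \<Longrightarrow> p ^ 3 \<le> \<nu> \<Longrightarrow>
    norm (wkb_W \<nu> p - of_real (1 / sqrt (2 * pi)) * (wkb_Y K \<nu> p + cnj (wkb_Y K \<nu> p)))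
    \<le> C / \<nu> ^ Suc K * (p + p ^ (3 * Suc K))"
    using wkb_error by blast
  have "norm (bessel_J \<nu> r - (bessel_main \<nu> r + bessel_expansion K \<nu> r))
    \<le> C * (1 / (r\<^sup>2 - \<nu>\<^sup>2) powr (1/4) / \<nu> ^ Suc K *
        (\<nu> / sqrt (r\<^sup>2 - \<nu>\<^sup>2) + (\<nu> / sqrt (r\<^sup>2 - \<nu>\<^sup>2)) ^ (3 * Suc K)))"
    if \<nu>: "\<nu> > 10" and r: "r > \<nu> + \<nu> powr (1/3)" for \<nu> r
  proof -
    define Q where "Q = r\<^sup>2 - \<nu>\<^sup>2"
    define p where "p = \<nu> / sqrt Q"
    have pw: "\<nu> powr (1/3) > 0" using \<nu> by simp
    have \<nu>r: "\<nu> > 0" "r > \<nu>" using \<nu> r pw by linarith+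
    note geo = bessel_geometry[OF \<nu>r, folded Q_def, folded p_def]
    \<comment> \<open>The distance from the turning point enters here: Q = (r - \<nu>) (r + \<nu>)
      \<ge> \<nu>^{4/3}, hence p \<le> \<nu>^{1/3}.\<close>
    have "p ^ 3 \<le> \<nu>"
    proof -
      have "\<nu> powr (1/3) * \<nu> \<le> (r - \<nu>) * (r + \<nu>)"
        by (intro mult_mono) (use \<nu> r pw \<nu>r in linarith)+
      also have "(r - \<nu>) * (r + \<nu>) = Q"
        by (simp add: Q_def power2_eq_square algebra_simps)
      also have "\<nu> powr (1/3) * \<nu> = (\<nu> powr (2/3))\<^sup>2"
        using \<nu> powr_add[of \<nu> "1/3" 1] by (simp add: power2_eq_square flip: powr_add)
      finally have "(\<nu> powr (2/3))\<^sup>2 \<le> Q" .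
      then have "\<nu> powr (2/3) \<le> sqrt Q"
        by (intro real_le_rsqrt)
      then have "p \<le> \<nu> / \<nu> powr (2/3)"
        unfolding p_def using \<nu> by (intro divide_left_mono mult_pos_pos) (auto simp: geo(1))
      also have "\<dots> = \<nu> powr (1/3)"
        using \<nu> powr_diff[of \<nu> 1 "2/3"] by simp
      finally have "p ^ 3 \<le> (\<nu> powr (1/3)) ^ 3"
        using geo(2) by (intro power_mono) auto
      also have "\<dots> = \<nu>"
        using \<nu> by (simp add: powr_powr flip: powr_realpow)
      finally show ?thesis .
    qed
    then have bd: "norm (wkb_W \<nu> p - of_real (1 / sqrt (2 * pi)) * (wkb_Y K \<nu> p + cnj (wkb_Y K \<nu> p)))
        \<le> C / \<nu> ^ Suc K * (p + p ^ (3 * Suc K))"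
      using C(2) \<nu> geo(2) by simp
    have W: "bessel_J \<nu> r = of_real (1 / Q powr (1/4)) * wkb_W \<nu> p"
      unfolding wkb_W_def geo(3,5) using geo(1) by simp
    have "norm (bessel_J \<nu> r - (bessel_main \<nu> r + bessel_expansion K \<nu> r))
      = 1 / Q powr (1/4) * norm (wkb_W \<nu> p - of_real (1 / sqrt (2 * pi)) * (wkb_Y K \<nu> p + cnj (wkb_Y K \<nu> p)))"
      unfolding bessel_main_expansion[OF \<nu>r, folded Q_def, folded p_def] W right_diff_distrib[symmetric] norm_mult
      by (simp add: norm_divide)
    also have "\<dots> \<le> 1 / Q powr (1/4) * (C / \<nu> ^ Suc K * (p + p ^ (3 * Suc K)))"
      by (intro mult_left_mono bd) simp
    finally show ?thesis by (simp add: Q_def p_def mult_ac)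
  qed
  then show ?thesis using C(1) by (rule that[rotated])
qed

text \<open>For r \<le> 2\<nu> one has p \<ge> 1/2, so p^{3K+3} dominates p up to a power of 2. The
  exponent of Q is 1/4 + (3K + 3) / 2 = 3K/2 + 7/4.\<close>

lemma error_bound_near:
  assumes \<nu>: "\<nu> > 0" and r: "r > \<nu>" "r \<le> 2 * \<nu>"
  defines "Q \<equiv> r\<^sup>2 - \<nu>\<^sup>2"
  shows "1 / Q powr (1/4) / \<nu> ^ Suc K * (\<nu> / sqrt Q + (\<nu> / sqrt Q) ^ (3 * Suc K))
    \<le> 2 ^ (3 * Suc K) * (\<nu> ^ (2 * Suc K) / Q powr (3 * real K / 2 + 7/4))"
proof -
  define p where "p = \<nu> / sqrt Q"
  note geo = bessel_geometry[OF \<nu> r(1), folded Q_def, folded p_def]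
  have "r\<^sup>2 \<le> (2 * \<nu>)\<^sup>2"
    using \<nu> r by (intro power_mono) auto
  then have "Q \<le> (2 * \<nu>)\<^sup>2"
    using zero_le_power2[of \<nu>] unfolding Q_def by linarith
  then have "sqrt Q \<le> 2 * \<nu>" using \<nu> by (simp add: real_le_lsqrt)
  then have p: "1 \<le> 2 * p" using geo(1) by (simp add: p_def field_simps)
  have "p + p ^ (3 * Suc K) \<le> 2 ^ (3 * Suc K) * p ^ (3 * Suc K)"
  proof -
    have "2 * p \<le> (2 * p) ^ (3 * Suc K)"
      using power_increasing[of 1 "3 * Suc K" "2 * p"] p by simp
    then have 1: "2 * p \<le> 2 ^ (3 * Suc K) * p ^ (3 * Suc K)" by (simp only: power_mult_distrib)
    have "2 ^ 1 * p ^ (3 * Suc K) \<le> 2 ^ (3 * Suc K) * p ^ (3 * Suc K)"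
      using geo(2) by (intro mult_right_mono power_increasing) auto
    with 1 show ?thesis by simp
  qed
  then have "1 / Q powr (1/4) / \<nu> ^ Suc K * (p + p ^ (3 * Suc K))
    \<le> 1 / Q powr (1/4) / \<nu> ^ Suc K * (2 ^ (3 * Suc K) * p ^ (3 * Suc K))"
    using \<nu> by (intro mult_left_mono) auto
  also have "\<dots> = 2 ^ (3 * Suc K) * (\<nu> ^ (2 * Suc K) / Q powr (3 * real K / 2 + 7/4))"
  proof -
    have "p ^ (3 * Suc K) = \<nu> ^ (3 * Suc K) / Q powr (real (3 * Suc K) / 2)"
      unfolding p_def power_divide using geo(1)
      by (simp add: powr_powr flip: powr_half_sqrt powr_realpow)
    also have "\<nu> ^ (3 * Suc K) = \<nu> ^ Suc K * \<nu> ^ (2 * Suc K)"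
    proof -
      have "3 * Suc K = Suc K + 2 * Suc K" by simp
      then show ?thesis by (simp only: power_add)
    qed
    finally have 1: "p ^ (3 * Suc K) = \<nu> ^ Suc K * \<nu> ^ (2 * Suc K) / Q powr (real (3 * Suc K) / 2)" .
    have "3 * real K / 2 + 7/4 = 1/4 + real (3 * Suc K) / 2" by (simp add: field_simps)
    then have 2: "Q powr (3 * real K / 2 + 7/4) = Q powr (1/4) * Q powr (real (3 * Suc K) / 2)"
      by (simp only: powr_add)
    have nz: "\<nu> ^ Suc K \<noteq> 0" using \<nu> by simp
    show ?thesis unfolding 1 2 using nz by (simp del: power_Suc)
  qed
  finally show ?thesis by (simp only: p_def)
qed

text \<open>Q \<ge> (r - \<nu>) r and \<nu> \<le> r; the power of r that is left is 2K + 2 - (3K/2 +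
  7/4) = K/2 + 1/4.\<close>

lemma error_bound_near':
  assumes \<nu>: "\<nu> > 0" and r: "r > \<nu>"
  shows "\<nu> ^ (2 * Suc K) / (r\<^sup>2 - \<nu>\<^sup>2) powr (3 * real K / 2 + 7/4)
    \<le> r powr (real K / 2 + 1/4) / (r - \<nu>) powr (3 * real K / 2 + 7/4)"
proof -
  define e where "e = 3 * real K / 2 + 7/4"
  have e: "e > 0" unfolding e_def by (intro add_nonneg_pos) auto
  have "(r - \<nu>) * r \<le> r\<^sup>2 - \<nu>\<^sup>2"
    using assms by (simp add: power2_eq_square algebra_simps)
  then have "((r - \<nu>) * r) powr e \<le> (r\<^sup>2 - \<nu>\<^sup>2) powr e"
    using assms e by (intro powr_mono2) auto
  then have "\<nu> ^ (2 * Suc K) / (r\<^sup>2 - \<nu>\<^sup>2) powr e \<le> r ^ (2 * Suc K) / ((r - \<nu>) * r) powr e"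
    using assms by (intro frac_le power_mono) auto
  also have "\<dots> = r powr (real (2 * Suc K)) / r powr e / (r - \<nu>) powr e"
    using assms by (subst powr_realpow) (simp_all add: powr_mult)
  also have "r powr (real (2 * Suc K)) / r powr e = r powr (real K / 2 + 1/4)"
    unfolding powr_diff[symmetric] e_def by (simp add: field_simps)
  finally show ?thesis by (simp only: e_def)
qed

text \<open>Here p \<le> 1, so p dominates its powers, and Q \<ge> r^2 / 4. As \<nu>^{-K-1} \<le>
  1/\<nu>, the left side is at most 2 Q^{-1/4} p / \<nu> = 2 Q^{-3/4}, whatever K is.\<close>

lemma error_bound_far:
  assumes \<nu>: "\<nu> \<ge> 1" and r: "r \<ge> 2 * \<nu>"
  defines "Q \<equiv> r\<^sup>2 - \<nu>\<^sup>2"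
  shows "1 / Q powr (1/4) / \<nu> ^ Suc K * (\<nu> / sqrt Q + (\<nu> / sqrt Q) ^ (3 * Suc K)) \<le> 8 * r powr (-3/2)"
proof -
  define p where "p = \<nu> / sqrt Q"
  have \<nu>r: "\<nu> > 0" "r > \<nu>" using \<nu> r by auto
  note geo = bessel_geometry[OF \<nu>r, folded Q_def, folded p_def]
  have r2: "(2 * \<nu>)\<^sup>2 \<le> r\<^sup>2" using \<nu> r by (intro power_mono) auto
  have "(2 * \<nu>)\<^sup>2 = 4 * \<nu>\<^sup>2" "(r / 2)\<^sup>2 = r\<^sup>2 / 4"
    by (simp_all add: power_mult_distrib power_divide)
  then have Qr: "(r / 2)\<^sup>2 \<le> Q" and Q\<nu>: "\<nu>\<^sup>2 \<le> Q"
    using r2 zero_le_power2[of \<nu>] zero_le_power2[of r] unfolding Q_def by linarith+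
  have "\<nu> \<le> sqrt Q" using Q\<nu> by (rule real_le_rsqrt)
  then have p1: "p \<le> 1" using geo(1) by (simp add: p_def)
  have "p ^ (3 * Suc K) \<le> p ^ 1" using geo(2) p1 by (intro power_decreasing) auto
  then have "1 / Q powr (1/4) / \<nu> ^ Suc K * (p + p ^ (3 * Suc K)) \<le> 1 / Q powr (1/4) / \<nu> ^ Suc K * (2 * p)"
    using \<nu>r by (intro mult_left_mono) auto
  also have "\<dots> \<le> 1 / Q powr (1/4) / \<nu> ^ 1 * (2 * p)"
    using \<nu> geo(1,2) by (intro mult_right_mono divide_left_mono power_increasing) auto
  also have "\<dots> = 2 * Q powr (-3/4)"
  proof -
    have "Q powr (-3/4) = 1 / (Q powr (1/4) * Q powr (1/2))"
      by (simp add: powr_minus_divide flip: powr_add)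
    then show ?thesis
      unfolding p_def using \<nu>r geo(1) by (simp add: powr_half_sqrt)
  qed
  also have "\<dots> \<le> 2 * ((r / 2)\<^sup>2) powr (-3/4)"
    using Qr \<nu>r by (intro mult_left_mono powr_mono2') auto
  also have "((r / 2)\<^sup>2) powr (-3/4) = (r / 2) powr (-3/2)"
    using \<nu>r by (simp add: powr_powr flip: powr_numeral)
  also have "\<dots> = r powr (-3/2) * 2 powr (3/2)"
    using \<nu>r by (simp add: powr_divide powr_minus_divide)
  \<comment> \<open>2^{3/2} is rounded up to 4, whence the constant 8.\<close>
  also have "2 * (r powr (-3/2) * 2 powr (3/2)) \<le> 2 * (r powr (-3/2) * 2 powr 2)"
    by (intro mult_left_mono powr_mono) auto
  finally show ?thesis by (simp add: p_def)
qed

text \<open>The sum of the two constants serves both ranges, including the point r = 2\<nu> where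
  the indicators overlap.\<close>

lemma indicator_bound:
  fixes X Y N C1 C2 \<nu> r t :: real
  assumes "r \<le> 2 * \<nu> \<Longrightarrow> N \<le> C1 * X" "r \<ge> 2 * \<nu> \<Longrightarrow> N \<le> C2 * Y"
    and "X \<ge> 0" "Y \<ge> 0" "C1 \<ge> 0" "C2 \<ge> 0" "r > t"
  shows "N \<le> (C1 + C2) * (X * indicat_real {t..2 * \<nu>} r + Y * indicat_real {2 * \<nu>..} r)"
proof (cases "r \<le> 2 * \<nu>")
  case True
  have "N \<le> C1 * X" using assms True by simp
  also have "\<dots> \<le> (C1 + C2) * (X + Y * indicat_real {2 * \<nu>..} r)"
    using assms by (intro mult_mono add_nonneg_nonneg) auto
  finally show ?thesis using True assms by (simp add: indicator_def)
next
  case False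
  have "N \<le> C2 * Y" using assms False by simp
  also have "\<dots> \<le> (C1 + C2) * Y"
    using assms by (intro mult_right_mono) auto
  finally show ?thesis using False by (simp add: indicator_def)
qed

text \<open>One constant for both ranges: the factor 2^{3K+3} of the near range is at least the 8 of
  the far range.\<close>

lemma debye_expansion_near_far:
  obtains C where "C > 0"
    "\<And>\<nu> r. \<nu> > 10 \<Longrightarrow> r > \<nu> + \<nu> powr (1/3) \<Longrightarrow> r \<le> 2 * \<nu> \<Longrightarrow>
      norm (bessel_J \<nu> r - (bessel_main \<nu> r + bessel_expansion K \<nu> r))
      \<le> C * (\<nu> ^ (2 * Suc K) / (r\<^sup>2 - \<nu>\<^sup>2) powr (3 * real K / 2 + 7/4))"
    "\<And>\<nu> r. \<nu> > 10 \<Longrightarrow> r > \<nu> + \<nu> powr (1/3) \<Longrightarrow> r \<ge> 2 * \<nu> \<Longrightarrow>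
      norm (bessel_J \<nu> r - (bessel_main \<nu> r + bessel_expansion K \<nu> r)) \<le> C * r powr (-3/2)"
proof -
  obtain C where C: "C > 0" "\<And>\<nu> r. \<nu> > 10 \<Longrightarrow> r > \<nu> + \<nu> powr (1/3) \<Longrightarrow>
    norm (bessel_J \<nu> r - (bessel_main \<nu> r + bessel_expansion K \<nu> r))
    \<le> C * (1 / (r\<^sup>2 - \<nu>\<^sup>2) powr (1/4) / \<nu> ^ Suc K *
        (\<nu> / sqrt (r\<^sup>2 - \<nu>\<^sup>2) + (\<nu> / sqrt (r\<^sup>2 - \<nu>\<^sup>2)) ^ (3 * Suc K)))"
    using debye_expansion by blast
  have C8: "(8::real) \<le> 2 ^ (3 * Suc K)"
    using power_increasing[of 3 "3 * Suc K" "2::real"] by simp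
  show ?thesis
  proof (rule that[of "C * 2 ^ (3 * Suc K)"])
    show "C * 2 ^ (3 * Suc K) > 0" using C(1) by simp
  next
    fix \<nu> r :: real assume \<nu>: "\<nu> > 10" and r: "r > \<nu> + \<nu> powr (1/3)"
    have \<nu>r: "\<nu> > 0" "r > \<nu>" using \<nu> r powr_ge_zero[of \<nu> "1/3"] by linarith+
    note bd = C(2)[OF \<nu> r]
    show "norm (bessel_J \<nu> r - (bessel_main \<nu> r + bessel_expansion K \<nu> r))
      \<le> C * 2 ^ (3 * Suc K) * (\<nu> ^ (2 * Suc K) / (r\<^sup>2 - \<nu>\<^sup>2) powr (3 * real K / 2 + 7/4))" if "r \<le> 2 * \<nu>"
      using order_trans[OF bd mult_left_mono[OF error_bound_near[OF \<nu>r that]]] C(1)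
      by (simp only: mult.assoc less_imp_le)
    have "norm (bessel_J \<nu> r - (bessel_main \<nu> r + bessel_expansion K \<nu> r)) \<le> C * (8 * r powr (-3/2))" if "2 * \<nu> \<le> r"
      using order_trans[OF bd mult_left_mono[OF error_bound_far[OF _ that]]] C(1) \<nu> by simp
    also have "C * (8 * r powr (-3/2)) \<le> C * (2 ^ (3 * Suc K) * r powr (-3/2))"
      using C(1) C8 by (intro mult_left_mono mult_right_mono) auto
    finally show "norm (bessel_J \<nu> r - (bessel_main \<nu> r + bessel_expansion K \<nu> r))
      \<le> C * 2 ^ (3 * Suc K) * r powr (-3/2)" if "2 * \<nu> \<le> r"
      using that by (simp only: mult.assoc)
  qed
qed

section \<open>Error terms with indicator functions\<close>

lemma powr_le_inverse: "r powr (-3/2) \<le> 1 / r" if "r \<ge> 1" for r :: real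
  using that powr_mono[of "-3/2" "-1" r] by (simp add: powr_minus_divide)

text \<open>Passage from bounds on the two ranges to the two shapes in the theorem; the first shape
  relaxes r^{-3/2} to 1/r and allows an extra 1/r near the turning point. \<open>X\<close> is
  abstract because h and its remainders have different near bounds.\<close>

lemma error_term_bounds:
  fixes N X :: "real \<Rightarrow> real \<Rightarrow> real"
  assumes C: "C > 0" and X: "\<And>\<nu> r. X \<nu> r \<ge> 0"
    and near: "\<And>\<nu> r. \<nu> > 10 \<Longrightarrow> r > \<nu> + \<nu> powr (1/3) \<Longrightarrow> r \<le> 2 * \<nu> \<Longrightarrow> N \<nu> r \<le> C * X \<nu> r"
    and far: "\<And>\<nu> r. \<nu> > 10 \<Longrightarrow> r > \<nu> + \<nu> powr (1/3) \<Longrightarrow> r \<ge> 2 * \<nu> \<Longrightarrow> N \<nu> r \<le> C * r powr (-3/2)"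
  shows "\<exists>C. \<forall>\<nu> r. \<nu> > 10 \<and> r > \<nu> + \<nu> powr (1/3) \<longrightarrow> N \<nu> r \<le> C *
      ((X \<nu> r + 1 / r) * indicat_real {\<nu> + \<nu> powr (1/3)..2 * \<nu>} r + 1 / r * indicat_real {2 * \<nu>..} r)"
    and "\<exists>C. \<forall>\<nu> r. \<nu> > 10 \<and> r > \<nu> + \<nu> powr (1/3) \<and> \<nu> \<in> \<int> \<longrightarrow> N \<nu> r \<le> C *
      (X \<nu> r * indicat_real {\<nu> + \<nu> powr (1/3)..2 * \<nu>} r + r powr (-3/2) * indicat_real {2 * \<nu>..} r)"
proof -
  show "\<exists>C. \<forall>\<nu> r. \<nu> > 10 \<and> r > \<nu> + \<nu> powr (1/3) \<and> \<nu> \<in> \<int> \<longrightarrow> N \<nu> r \<le> C *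
      (X \<nu> r * indicat_real {\<nu> + \<nu> powr (1/3)..2 * \<nu>} r + r powr (-3/2) * indicat_real {2 * \<nu>..} r)"
  proof (intro exI allI impI, elim conjE)
    fix \<nu> r :: real assume A: "\<nu> > 10" "r > \<nu> + \<nu> powr (1/3)"
    show "N \<nu> r \<le> (C + C) *
      (X \<nu> r * indicat_real {\<nu> + \<nu> powr (1/3)..2 * \<nu>} r + r powr (-3/2) * indicat_real {2 * \<nu>..} r)"
      by (rule indicator_bound[OF near[OF A] far[OF A]]) (use C A X in auto)
  qed
  show "\<exists>C. \<forall>\<nu> r. \<nu> > 10 \<and> r > \<nu> + \<nu> powr (1/3) \<longrightarrow> N \<nu> r \<le> C *
      ((X \<nu> r + 1 / r) * indicat_real {\<nu> + \<nu> powr (1/3)..2 * \<nu>} r + 1 / r * indicat_real {2 * \<nu>..} r)"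
  proof (intro exI allI impI, elim conjE)
    fix \<nu> r :: real assume A: "\<nu> > 10" "r > \<nu> + \<nu> powr (1/3)"
    have r: "r \<ge> 1" using A powr_ge_zero[of \<nu> "1/3"] by linarith
    show "N \<nu> r \<le> (C + C) *
      ((X \<nu> r + 1 / r) * indicat_real {\<nu> + \<nu> powr (1/3)..2 * \<nu>} r + 1 / r * indicat_real {2 * \<nu>..} r)"
    proof (rule indicator_bound)
      assume "r \<le> 2 * \<nu>"
      from near[OF A this] show "N \<nu> r \<le> C * (X \<nu> r + 1 / r)"
        by (rule order_trans) (use C r in \<open>intro mult_left_mono, auto\<close>)
    next
      assume "r \<ge> 2 * \<nu>"
      from far[OF A this] show "N \<nu> r \<le> C * (1 / r)"
        by (rule order_trans) (use C powr_le_inverse[OF r] in \<open>intro mult_left_mono, auto\<close>)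
    qed (use C r A X in auto)
  qed
qed

theorem lemma3p1:
  shows "\<exists>h :: real \<Rightarrow> real \<Rightarrow> complex.
    (\<forall>\<nu> r. \<nu> > 10 \<and> r > \<nu> + \<nu> powr (1/3) \<longrightarrow>
       bessel_J \<nu> r = bessel_main \<nu> r + h \<nu> r) \<and>
    (\<exists>C::real. \<forall>\<nu> r. \<nu> > 10 \<and> r > \<nu> + \<nu> powr (1/3) \<longrightarrow>
       norm (h \<nu> r) \<le> C *
         ((\<nu>\<^sup>2 / (r\<^sup>2 - \<nu>\<^sup>2) powr (7/4) + 1 / r) * indicat_real {\<nu> + \<nu> powr (1/3)..2 * \<nu>} r
          + 1 / r * indicat_real {2 * \<nu>..} r)) \<and>
    (\<exists>a a' :: nat \<Rightarrow> real \<Rightarrow> complex.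
       (\<forall>k\<ge>1. smooth_on_open {0<..<pi/2} (a k) \<and> smooth_on_open {0<..<pi/2} (a' k)) \<and>
       (\<forall>k\<ge>1. \<forall>l. \<exists>C::real. \<forall>x\<in>{0<..<pi/2}.
          norm (nth_derivative l (a k) x) + norm (nth_derivative l (a' k) x) \<le> C) \<and>
       (\<forall>K::nat. \<exists>ht :: real \<Rightarrow> real \<Rightarrow> complex.
          (\<forall>\<nu> r. \<nu> > 10 \<and> r > \<nu> + \<nu> powr (1/3) \<longrightarrow>
             h \<nu> r =
               of_real ((2 * pi) powr (-1/2)) * exp (\<i> * of_real (bessel_theta \<nu> r)) * bessel_sum a K \<nu> r
             + of_real ((2 * pi) powr (-1/2)) * exp (- \<i> * of_real (bessel_theta \<nu> r)) * bessel_sum a' K \<nu> r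
             + ht \<nu> r) \<and>
          (\<exists>C::real. \<forall>\<nu> r. \<nu> > 10 \<and> r > \<nu> + \<nu> powr (1/3) \<longrightarrow>
             norm (ht \<nu> r) \<le> C *
               ((r powr (real K / 2 + 1/4) / (r - \<nu>) powr (3 * real K / 2 + 7/4) + 1 / r)
                  * indicat_real {\<nu> + \<nu> powr (1/3)..2 * \<nu>} r
                + 1 / r * indicat_real {2 * \<nu>..} r)) \<and>
          (\<exists>C::real. \<forall>\<nu> r. \<nu> > 10 \<and> r > \<nu> + \<nu> powr (1/3) \<and> \<nu> \<in> \<int> \<longrightarrow>
             norm (ht \<nu> r) \<le> C *
               (r powr (real K / 2 + 1/4) / (r - \<nu>) powr (3 * real K / 2 + 7/4)
                  * indicat_real {\<nu> + \<nu> powr (1/3)..2 * \<nu>} r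
                + r powr (-3/2) * indicat_real {2 * \<nu>..} r))))"
proof -
  define a where "a = (\<lambda>k x. debye_amp k (complex_of_real x))"
  \<comment> \<open>Conjugate amplitudes on e^{-i\<theta>} make the whole expansion real, like the
    main term.\<close>
  define a' where "a' = (\<lambda>k x. cnj (debye_amp k (complex_of_real x)))"
  define h where "h = (\<lambda>\<nu> r. bessel_J \<nu> r - bessel_main \<nu> r)"
  define ht where "ht = (\<lambda>K \<nu> r. h \<nu> r - bessel_expansion K \<nu> r)"
  have ht: "ht K \<nu> r = bessel_J \<nu> r - (bessel_main \<nu> r + bessel_expansion K \<nu> r)" for K \<nu> r
    by (simp add: ht_def h_def)
  \<comment> \<open>For K = 0 the sums are empty, so the bound on h is the remainder bound with
    exponents 2 (K + 1) = 2 and 3K/2 + 7/4 = 7/4.\<close>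
  have ht0: "ht 0 \<nu> r = h \<nu> r" for \<nu> r
    by (simp add: ht_def bessel_expansion_def bessel_sum_def)
  have h1: "\<forall>\<nu> r. \<nu> > 10 \<and> r > \<nu> + \<nu> powr (1/3) \<longrightarrow> bessel_J \<nu> r = bessel_main \<nu> r + h \<nu> r"
    by (simp add: h_def)
  have h2: "\<exists>C::real. \<forall>\<nu> r. \<nu> > 10 \<and> r > \<nu> + \<nu> powr (1/3) \<longrightarrow>
       norm (h \<nu> r) \<le> C *
         ((\<nu>\<^sup>2 / (r\<^sup>2 - \<nu>\<^sup>2) powr (7/4) + 1 / r) * indicat_real {\<nu> + \<nu> powr (1/3)..2 * \<nu>} r
          + 1 / r * indicat_real {2 * \<nu>..} r)"
  proof (rule debye_expansion_near_far[of 0], unfold ht[symmetric] ht0)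
    fix C :: real
    assume "C > 0" and "\<And>\<nu> r. \<nu> > 10 \<Longrightarrow> r > \<nu> + \<nu> powr (1/3) \<Longrightarrow> r \<le> 2 * \<nu> \<Longrightarrow>
        norm (h \<nu> r) \<le> C * (\<nu> ^ (2 * Suc 0) / (r\<^sup>2 - \<nu>\<^sup>2) powr (3 * real 0 / 2 + 7/4))"
      and "\<And>\<nu> r. \<nu> > 10 \<Longrightarrow> r > \<nu> + \<nu> powr (1/3) \<Longrightarrow> r \<ge> 2 * \<nu> \<Longrightarrow>
        norm (h \<nu> r) \<le> C * r powr (-3/2)"
    then show ?thesis
      by (intro error_term_bounds(1)[where X = "\<lambda>\<nu> r. \<nu>\<^sup>2 / (r\<^sup>2 - \<nu>\<^sup>2) powr (7/4)"]) simp_all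
  qed
  have s1: "\<forall>k\<ge>1. smooth_on_open {0<..<pi/2} (a k) \<and> smooth_on_open {0<..<pi/2} (a' k)"
    unfolding a_def a'_def using debye_amp_smooth(1,2) by blast
  have s2: "\<forall>k\<ge>1. \<forall>l. \<exists>C::real. \<forall>x\<in>{0<..<pi/2}.
          norm (nth_derivative l (a k) x) + norm (nth_derivative l (a' k) x) \<le> C"
    unfolding a_def a'_def using debye_amp_smooth(3) by blast
  have t1: "\<forall>\<nu> r. \<nu> > 10 \<and> r > \<nu> + \<nu> powr (1/3) \<longrightarrow>
             h \<nu> r =
               of_real ((2 * pi) powr (-1/2)) * exp (\<i> * of_real (bessel_theta \<nu> r)) * bessel_sum a K \<nu> r
             + of_real ((2 * pi) powr (-1/2)) * exp (- \<i> * of_real (bessel_theta \<nu> r)) * bessel_sum a' K \<nu> r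
             + ht K \<nu> r" for K
    unfolding ht_def bessel_expansion_def a_def a'_def by simp
  have t: "\<exists>C::real. \<forall>\<nu> r. \<nu> > 10 \<and> r > \<nu> + \<nu> powr (1/3) \<longrightarrow>
             norm (ht K \<nu> r) \<le> C *
               ((r powr (real K / 2 + 1/4) / (r - \<nu>) powr (3 * real K / 2 + 7/4) + 1 / r)
                  * indicat_real {\<nu> + \<nu> powr (1/3)..2 * \<nu>} r
                + 1 / r * indicat_real {2 * \<nu>..} r)" (is ?t2)
    "\<exists>C::real. \<forall>\<nu> r. \<nu> > 10 \<and> r > \<nu> + \<nu> powr (1/3) \<and> \<nu> \<in> \<int> \<longrightarrow>
             norm (ht K \<nu> r) \<le> C *
               (r powr (real K / 2 + 1/4) / (r - \<nu>) powr (3 * real K / 2 + 7/4)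
                  * indicat_real {\<nu> + \<nu> powr (1/3)..2 * \<nu>} r
                + r powr (-3/2) * indicat_real {2 * \<nu>..} r)" (is ?t3) for K
  proof -
    obtain C where C: "C > 0"
      "\<And>\<nu> r. \<nu> > 10 \<Longrightarrow> r > \<nu> + \<nu> powr (1/3) \<Longrightarrow> r \<le> 2 * \<nu> \<Longrightarrow>
        norm (ht K \<nu> r) \<le> C * (\<nu> ^ (2 * Suc K) / (r\<^sup>2 - \<nu>\<^sup>2) powr (3 * real K / 2 + 7/4))"
      "\<And>\<nu> r. \<nu> > 10 \<Longrightarrow> r > \<nu> + \<nu> powr (1/3) \<Longrightarrow> r \<ge> 2 * \<nu> \<Longrightarrow>
        norm (ht K \<nu> r) \<le> C * r powr (-3/2)"
      unfolding ht by (rule debye_expansion_near_far) blast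
    \<comment> \<open>For the remainders the near bound is rewritten from powers of r^2 - \<nu>^2 to
      powers of r and r - \<nu>.\<close>
    have near: "norm (ht K \<nu> r) \<le> C * (r powr (real K / 2 + 1/4) / (r - \<nu>) powr (3 * real K / 2 + 7/4))"
      if A: "\<nu> > 10" "r > \<nu> + \<nu> powr (1/3)" "r \<le> 2 * \<nu>" for \<nu> r
    proof (rule order_trans[OF C(2)[OF A] mult_left_mono[OF error_bound_near']])
      show "\<nu> > 0" "r > \<nu>" using A powr_ge_zero[of \<nu> "1/3"] by linarith+
    qed (use C(1) in simp)
    show ?t2
      by (rule error_term_bounds(1)[OF C(1) _ near C(3)]) simp_all
    show ?t3
      by (rule error_term_bounds(2)[OF C(1) _ near C(3)]) simp_all
  qed
  show ?thesis
    by (rule exI[of _ h], rule conjI[OF h1], rule conjI[OF h2], rule exI[of _ a], rule exI[of _ a'],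
        rule conjI[OF s1], rule conjI[OF s2], rule allI, rule exI[of _ "ht K" for K],
        rule conjI[OF t1], rule conjI[OF t])
qed

end
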